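(* Let $X_1, \dots, X_{n-1}$ be random vectors in $\mathbb{R}^n$ whose coordinates are independent copies of a centered subgaussian random variable $\xi$ of unit variance. There exist constants $\gamma\in(0,1)$, $\beta > 0$ and $c, c' > 0$, depending only on the distribution of $\xi$, such that, with $\alpha = \beta\sqrt n$ and $\mathrm{LCD}_\alpha$ defined with parameter $\gamma$, $$\mathbb{P}\big(\text{there exists a unit vector } Z \text{ orthogonal to } X_1,\dots,X_{n-1} \text{ with } \mathrm{LCD}_\alpha(Z) < e^{cn}\big) \le e^{-c'n}.$$
   Context: A real random variable $\xi$ is subgaussian if there exist constants $C, v > 0$ such that $\mathbb{P}(|\xi| > t) \le C e^{-v t^2}$ for all $t > 0$; centered means $\mathbb{E}\xi=0$. For $\alpha > 0$ and $a \in \mathbb{R}^n$, the essential least common denominator (with parameter $\gamma$) is $\mathrm{LCD}_\alpha(a) = \inf\{\theta > 0 : \mathrm{dist}(\theta a, \mathbb{Z}^n) < \min(\gamma\|\theta a\|_2, \alpha)\}$.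
   Formalization: The bound is proved for all n ≥ n0, with n0 depending only on the distribution of ξ; for n = 1 the claim is false (Z = ±1 has LCD < 1, so the probability is 1), and the cases 2 ≤ n < n0 follow by shrinking γ, c and c'. *)

theory Defs
  imports "HOL-Probability.Probability"
begin

text \<open>Vectors in R^n are represented as functions nat => real, only the
coordinates 0..n-1 being relevant.\<close>

definition vnorm :: "nat \<Rightarrow> (nat \<Rightarrow> real) \<Rightarrow> real" where
  "vnorm n a = sqrt (\<Sum>j<n. (a j)\<^sup>2)"

definition dist_lattice :: "nat \<Rightarrow> (nat \<Rightarrow> real) \<Rightarrow> real" where
  "dist_lattice n a = Inf {vnorm n (\<lambda>j. a j - of_int (p j)) | p :: nat \<Rightarrow> int. True}"

text \<open>Essential least common denominator with parameter gamma; the infimum of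
the empty set is +infinity (hence the values in ereal).\<close>
definition LCD :: "nat \<Rightarrow> real \<Rightarrow> real \<Rightarrow> (nat \<Rightarrow> real) \<Rightarrow> ereal" where
  "LCD n \<gamma> \<alpha> a = (INF \<theta> \<in> {\<theta>::real. \<theta> > 0 \<and>
      dist_lattice n (\<lambda>j. \<theta> * a j) < min (\<gamma> * vnorm n (\<lambda>j. \<theta> * a j)) \<alpha>}. ereal \<theta>)"

definition subgaussian :: "real measure \<Rightarrow> bool" where
  "subgaussian \<mu> \<longleftrightarrow> (\<exists>C v. C > 0 \<and> v > 0 \<and>
      (\<forall>t>0. measure \<mu> {x \<in> space \<mu>. \<bar>x\<bar> > t} \<le> C * exp (- v * t\<^sup>2)))"

end

theory Submission
  imports Defs
begin

text \<open>
  Let \<open>B\<close> be the matrix with rows \<open>X\<^sub>i\<close>. Outside an event of exponentially small probability its operator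
  norm is at most \<open>K sqrt n\<close>. If \<open>\<theta> Z\<close> is close to an integer vector \<open>p\<close>, for a unit vector \<open>Z\<close> with \<open>B Z = 0\<close>,
  then \<open>Z\<close> is close to \<open>p / |p|\<close>. So the vectors \<open>Z\<close> with a given bound on the essential LCD fall into
  cells labelled by integer vectors, and \<open>|B x|\<close> is small for one fixed representative \<open>x\<close> of the cell of \<open>Z\<close>.
  For a fixed \<open>x\<close> this is unlikely, because the Laplace transform of \<open>|B x|\<^sup>2\<close> is the \<open>(n - 1)\<close>-st power of that of
  \<open>\<langle>X, x\<rangle>\<^sup>2\<close>.

  If the LCD is below \<open>c\<^sub>0 sqrt n\<close>, there are only \<open>exp (2 \<delta> n)\<close> labels, while
  \<open>E exp (- \<langle>X, x\<rangle>\<^sup>2 / Q) \<le> 1 - 1 / (2 Q)\<close> for all unit vectors \<open>x\<close>.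

  If the LCD lies in \<open>[D, 2 D)\<close> with \<open>D \<ge> c\<^sub>0 sqrt n\<close>, there are at most \<open>(C D / sqrt n)\<^sup>n\<close> labels, and the cells have
  diameter of order \<open>\<beta> sqrt n / D\<close>. The representative \<open>x\<close> also has LCD at least \<open>D\<close>, and for such \<open>x\<close> the Fourier
  transform gives \<open>E exp (- \<langle>X, x\<rangle>\<^sup>2 / (2 t\<^sup>2)) \<le> C t / \<gamma>\<close> at the scale \<open>t = 4 K \<beta> sqrt n / D\<close>. The union bound
  \<open>(C \<beta> / \<gamma>)\<^bsup>n - 1\<^esup> D\<close> is exponentially small for small \<open>\<beta>\<close> as long as \<open>D \<le> exp (c n)\<close>.
\<close>

section \<open>Elementary inequalities\<close>

lemma exp_minus_le_quadratic:
  fixes y :: real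
  assumes "0 \<le> y"
  shows "exp (- y) \<le> 1 - y + y\<^sup>2 / 2"
proof -
  obtain t where "exp (- y) = (\<Sum>m<3. (- y) ^ m / fact m) + exp t / fact 3 * (- y) ^ 3"
    using Maclaurin_exp_le[of "- y" 3] by blast
  moreover have "exp t / fact 3 * (- y) ^ 3 \<le> 0"
    using assms by simp
  ultimately show ?thesis
    by (simp add: numeral_3_eq_3 power2_eq_square)
qed

lemma exp_le_add_exp_square: "exp x \<le> x + exp (x\<^sup>2)" for x :: real
proof -
  have sq: "1 + x\<^sup>2 \<le> exp (x\<^sup>2)" by simp
  consider "x > 1" | "0 \<le> x" "x \<le> 1" | "- 1 \<le> x" "x < 0" | "x < - 1" by linarith
  then show ?thesis
  proof cases
    case 1
    then have "exp x \<le> exp (x\<^sup>2)" by (simp add: power2_eq_square)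
    then show ?thesis using 1 by linarith
  next
    case 2
    then show ?thesis using exp_bound[of x] sq by linarith
  next
    case 3
    then have "exp x \<le> 1 + x + x\<^sup>2 / 2" using exp_minus_le_quadratic[of "- x"] by simp
    then show ?thesis using sq zero_le_power2[of x] by linarith
  next
    case 4
    then have "exp x \<le> 1" "0 \<le> x * (x + 1)" by (auto simp: mult_nonpos_nonpos)
    moreover have "x * (x + 1) = x\<^sup>2 + x" by (simp add: power2_eq_square algebra_simps)
    ultimately show ?thesis using sq by linarith
  qed
qed

lemma power4_le_exp_sum: "x ^ 4 \<le> 256 * (exp x + exp (- x))" for x :: real
proof -
  have "(\<bar>x\<bar> / 4) ^ 4 \<le> exp (\<bar>x\<bar> / 4) ^ 4"
    using exp_ge_add_one_self[of "\<bar>x\<bar> / 4"] by (intro power_mono) linarith+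
  also have "exp (\<bar>x\<bar> / 4) ^ 4 = exp \<bar>x\<bar>" by (simp flip: exp_of_nat_mult)
  also have "\<dots> \<le> exp x + exp (- x)" by (simp add: abs_if)
  finally show ?thesis by (simp add: power_divide)
qed

lemma square_div_12_le_one_minus_cos:
  fixes y :: real
  assumes "\<bar>y\<bar> \<le> pi"
  shows "y\<^sup>2 / 12 \<le> 1 - cos y"
proof -
  obtain t where "cos y = (\<Sum>m<4. cos_coeff m * y ^ m) + (cos (t + 1/2 * real 4 * pi) / fact 4) * y ^ 4"
    using Maclaurin_cos_expansion[of y 4] by blast
  moreover have "(\<Sum>m<4. cos_coeff m * y ^ m) = 1 - y\<^sup>2 / 2"
    by (simp add: lessThan_nat_numeral cos_coeff_def fact_numeral)
  moreover have "(cos (t + 1/2 * real 4 * pi) / fact 4) * y ^ 4 \<le> (1 / fact 4) * y ^ 4"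
    by (intro mult_right_mono divide_right_mono) auto
  ultimately have taylor: "cos y \<le> 1 - y\<^sup>2 / 2 + y ^ 4 / 24"
    by (simp add: fact_numeral)
  have "y\<^sup>2 \<le> pi\<^sup>2" using assms by (metis abs_le_square_iff abs_of_nonneg pi_ge_zero)
  also have "pi\<^sup>2 \<le> (3.15)\<^sup>2" using pi_approx pi_ge_zero by (intro power_mono) auto
  finally have "y\<^sup>2 \<le> 10" by (simp add: power2_eq_square)
  then have "y\<^sup>2 * y\<^sup>2 \<le> 10 * y\<^sup>2" by (intro mult_right_mono) auto
  then have "y ^ 4 \<le> 10 * y\<^sup>2" by (simp flip: power_add)
  with taylor show ?thesis by linarith
qed

lemma std_normal_density_le_exp_abs: "std_normal_density u \<le> exp (- \<bar>u\<bar>)"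
proof -
  have "0 \<le> (\<bar>u\<bar> - 1)\<^sup>2" by simp
  then have "- u\<^sup>2 / 2 \<le> 1 / 2 - \<bar>u\<bar>" by (simp add: power2_eq_square field_simps)
  then have "exp (- u\<^sup>2 / 2) \<le> exp (1 / 2) * exp (- \<bar>u\<bar>)" by (simp flip: exp_add)
  also have "\<dots> \<le> sqrt (2 * pi) * exp (- \<bar>u\<bar>)"
  proof (intro mult_right_mono real_le_rsqrt)
    have "(exp (1 / 2))\<^sup>2 = exp (1 :: real)" by (simp add: power2_eq_square flip: exp_add)
    then show "(exp (1 / 2))\<^sup>2 \<le> 2 * pi" using exp_le pi_gt3 by linarith
  qed simp
  finally show ?thesis by (simp add: std_normal_density_def field_simps)
qed

section \<open>Gaussian integrals\<close>

lemma nn_integral_gaussian: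
  fixes a u\<^sub>0 :: real
  assumes "0 < a"
  shows "(\<integral>\<^sup>+u. ennreal (exp (- (a * (u - u\<^sub>0)\<^sup>2))) \<partial>lborel) = ennreal (sqrt (pi / a))"
proof -
  define \<sigma> where "\<sigma> = 1 / sqrt (2 * a)"
  have \<sigma>: "0 < \<sigma>" "\<sigma>\<^sup>2 = 1 / (2 * a)" using assms by (auto simp: \<sigma>_def power_divide)
  have density: "exp (- (a * (u - u\<^sub>0)\<^sup>2)) = sqrt (pi / a) * normal_density u\<^sub>0 \<sigma> u" for u
    using assms by (simp add: normal_density_def \<sigma>(2) field_simps)
  have "(\<integral>\<^sup>+u. ennreal (exp (- (a * (u - u\<^sub>0)\<^sup>2))) \<partial>lborel)
      = ennreal (\<integral>u. sqrt (pi / a) * normal_density u\<^sub>0 \<sigma> u \<partial>lborel)"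
    unfolding density using \<sigma>(1) assms by (intro nn_integral_eq_integral) auto
  then show ?thesis using \<sigma>(1) by simp
qed

lemma nn_integral_std_normal:
  assumes "f \<in> borel_measurable borel"
  shows "(\<integral>\<^sup>+u. f u \<partial>std_normal_distribution) = (\<integral>\<^sup>+u. ennreal (std_normal_density u) * f u \<partial>lborel)"
  using assms by (intro nn_integral_density) auto

lemma nn_integral_std_normal_exp_square:
  assumes "2 * l < 1"
  shows "(\<integral>\<^sup>+u. ennreal (exp (l * u\<^sup>2)) \<partial>std_normal_distribution) = ennreal (1 / sqrt (1 - 2 * l))"
proof -
  have "ennreal (std_normal_density u) * ennreal (exp (l * u\<^sup>2))
      = ennreal (1 / sqrt (2 * pi)) * ennreal (exp (- ((1 - 2 * l) / 2 * (u - 0)\<^sup>2)))" for u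
    by (simp add: std_normal_density_def field_simps flip: ennreal_mult exp_add)
  then have "(\<integral>\<^sup>+u. ennreal (exp (l * u\<^sup>2)) \<partial>std_normal_distribution)
      = ennreal (1 / sqrt (2 * pi)) * (\<integral>\<^sup>+u. ennreal (exp (- ((1 - 2 * l) / 2 * (u - 0)\<^sup>2))) \<partial>lborel)"
    by (simp add: nn_integral_std_normal nn_integral_cmult)
  also have "\<dots> = ennreal (1 / sqrt (2 * pi) * sqrt (pi / ((1 - 2 * l) / 2)))"
    using assms by (subst nn_integral_gaussian) (auto simp flip: ennreal_mult)
  also have "1 / sqrt (2 * pi) * sqrt (pi / ((1 - 2 * l) / 2)) = 1 / sqrt (1 - 2 * l)"
    using assms by (simp add: real_sqrt_divide real_sqrt_mult field_simps)
  finally show ?thesis .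
qed

lemma nn_integral_std_normal_exp_linear:
  "(\<integral>\<^sup>+u. ennreal (exp (c * u)) \<partial>std_normal_distribution) = ennreal (exp (c\<^sup>2 / 2))"
proof -
  have "ennreal (std_normal_density u) * ennreal (exp (c * u))
      = ennreal (exp (c\<^sup>2 / 2) / sqrt (2 * pi)) * ennreal (exp (- (1 / 2 * (u - c)\<^sup>2)))" for u
    by (simp add: std_normal_density_def power2_eq_square field_simps flip: ennreal_mult exp_add)
  then have "(\<integral>\<^sup>+u. ennreal (exp (c * u)) \<partial>std_normal_distribution)
      = ennreal (exp (c\<^sup>2 / 2) / sqrt (2 * pi)) * (\<integral>\<^sup>+u. ennreal (exp (- (1 / 2 * (u - c)\<^sup>2))) \<partial>lborel)"
    by (simp add: nn_integral_std_normal nn_integral_cmult del: times_divide_eq_left)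
  also have "\<dots> = ennreal (exp (c\<^sup>2 / 2))"
    by (subst nn_integral_gaussian) (simp_all add: real_sqrt_mult mult.commute flip: ennreal_mult)
  finally show ?thesis .
qed

lemma exp_minus_abs_le_weighted_indicators:
  fixes u l :: real
  assumes "0 < l"
  shows "ennreal (exp (- \<bar>u\<bar>)) \<le>
    (\<Sum>k. ennreal (exp (- l) ^ k) * (indicator {k * l..k * l + l} u + indicator {- (k * l) - l..- (k * l) - l + l} u))"
    (is "_ \<le> (\<Sum>k. ?w k * ?J k)")
proof -
  define k where "k = nat \<lfloor>\<bar>u\<bar> / l\<rfloor>"
  have "real k \<le> \<bar>u\<bar> / l" "\<bar>u\<bar> / l \<le> real k + 1"
    using assms by (auto simp: k_def)
  then have k: "k * l \<le> \<bar>u\<bar>" "\<bar>u\<bar> \<le> k * l + l"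
    using assms by (auto simp: field_simps)
  have "exp (- \<bar>u\<bar>) \<le> exp (- l) ^ k"
    using k(1) by (simp add: mult.commute flip: exp_of_nat_mult)
  then have "ennreal (exp (- \<bar>u\<bar>)) \<le> ?w k * 1"
    by (simp add: ennreal_leI)
  also have "\<dots> \<le> ?w k * ?J k"
    using k by (intro mult_left_mono) (auto simp: indicator_def abs_if split: if_splits)
  also have "\<dots> \<le> (\<Sum>k. ?w k * ?J k)"
    using sum_le_suminf[of "\<lambda>k. ?w k * ?J k" "{k}"] by simp
  finally show ?thesis .
qed

lemma suminf_exp_minus_power_le:
  assumes "0 < l"
  shows "(\<Sum>k. ennreal (exp (- l) ^ k)) \<le> ennreal (1 + 1 / l)"
proof -
  have "(\<Sum>k. ennreal (exp (- l) ^ k)) = ennreal (1 / (1 - exp (- l)))"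
    using assms suminf_geometric[of "exp (- l)"] by (subst suminf_ennreal2) (auto intro: summable_geometric)
  also have "\<dots> \<le> ennreal (1 + 1 / l)"
  proof (rule ennreal_leI)
    have "(1 + l) * exp (- l) \<le> exp l * exp (- l)" by (intro mult_right_mono) auto
    also have "\<dots> = 1" by (simp flip: exp_add)
    finally show "1 / (1 - exp (- l)) \<le> 1 + 1 / l" using assms by (simp add: field_simps)
  qed
  finally show ?thesis .
qed

lemma nn_integral_std_normal_le_intervals:
  assumes [measurable]: "f \<in> borel_measurable borel" and l: "0 < l"
    and interval: "\<And>s. (\<integral>\<^sup>+u. f u * indicator {s..s + l} u \<partial>lborel) \<le> B"
  shows "(\<integral>\<^sup>+u. f u \<partial>std_normal_distribution) \<le> ennreal (2 * (1 + 1 / l)) * B"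
proof -
  let ?w = "\<lambda>k. ennreal (exp (- l) ^ k)"
  let ?I = "\<lambda>s u. f u * indicator {s..s + l} u"
  have "ennreal (std_normal_density u) * f u
      \<le> (\<Sum>k. ?w k * (?I (k * l) u + ?I (- (k * l) - l) u))" for u
  proof -
    have "ennreal (std_normal_density u) \<le> ennreal (exp (- \<bar>u\<bar>))"
      by (intro ennreal_leI std_normal_density_le_exp_abs)
    then have "ennreal (std_normal_density u) * f u \<le>
        (\<Sum>k. ?w k * (indicator {k * l..k * l + l} u + indicator {- (k * l) - l..- (k * l) - l + l} u)) * f u"
      by (intro mult_right_mono order_trans[OF _ exp_minus_abs_le_weighted_indicators[OF l]]) auto
    also have "\<dots> = (\<Sum>k. ?w k * (?I (k * l) u + ?I (- (k * l) - l) u))"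
      unfolding ennreal_suminf_multc[symmetric] by (simp add: algebra_simps del: ennreal_suminf_cmult)
    finally show ?thesis .
  qed
  then have "(\<integral>\<^sup>+u. f u \<partial>std_normal_distribution)
      \<le> (\<integral>\<^sup>+u. (\<Sum>k. ?w k * (?I (k * l) u + ?I (- (k * l) - l) u)) \<partial>lborel)"
    by (simp add: nn_integral_std_normal nn_integral_mono)
  also have "\<dots> = (\<Sum>k. ?w k * ((\<integral>\<^sup>+u. ?I (k * l) u \<partial>lborel) + (\<integral>\<^sup>+u. ?I (- (k * l) - l) u \<partial>lborel)))"
    by (simp add: nn_integral_suminf nn_integral_cmult nn_integral_add)
  also have "\<dots> \<le> (\<Sum>k. ?w k * (B + B))"
    by (intro suminf_le mult_left_mono add_mono interval) auto
  also have "\<dots> = (\<Sum>k. ?w k) * (2 * B)"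
    by (simp add: mult_2)
  also have "\<dots> \<le> ennreal (1 + 1 / l) * (2 * B)"
    by (intro mult_right_mono suminf_exp_minus_power_le l) simp
  also have "\<dots> = ennreal (2 * (1 + 1 / l)) * B"
    using l by (subst ennreal_mult) (simp_all only: ennreal_numeral mult_ac, simp_all)
  finally show ?thesis .
qed

section \<open>Subgaussian distributions\<close>

definition variance_proxy :: "real measure \<Rightarrow> real \<Rightarrow> bool" where
  "variance_proxy N V \<longleftrightarrow> 0 \<le> V \<and> (\<forall>s. (\<integral>\<^sup>+x. ennreal (exp (s * x)) \<partial>N) \<le> ennreal (exp (V * s\<^sup>2 / 2)))"

lemma variance_proxyD:
  assumes "variance_proxy N V"
  shows "0 \<le> V" "(\<integral>\<^sup>+x. ennreal (exp (s * x)) \<partial>N) \<le> ennreal (exp (V * s\<^sup>2 / 2))"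
  using assms by (auto simp: variance_proxy_def)

context real_distribution
begin

lemma prob_exp_square_gt_le:
  assumes tail: "\<And>t. t > 0 \<Longrightarrow> prob {x. \<bar>x\<bar> > t} \<le> C * exp (- v * t\<^sup>2)"
    and "0 < v" "1 < t"
  shows "prob {x. t < exp (v / 2 * x\<^sup>2)} \<le> C * inverse (t\<^sup>2)"
proof -
  define r where "r = sqrt (2 * ln t / v)"
  have r: "0 < r" "v * r\<^sup>2 = 2 * ln t" using assms(2,3) by (auto simp: r_def)
  have "r < \<bar>x\<bar>" if "t < exp (v / 2 * x\<^sup>2)" for x
  proof -
    have "ln t < ln (exp (v / 2 * x\<^sup>2))"
      using that \<open>1 < t\<close> by (subst ln_less_cancel_iff) auto
    then have "r < sqrt (x\<^sup>2)"
      unfolding r_def using \<open>0 < v\<close> by (intro real_sqrt_less_mono) (simp add: field_simps)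
    then show ?thesis by simp
  qed
  then have "prob {x. t < exp (v / 2 * x\<^sup>2)} \<le> prob {x. r < \<bar>x\<bar>}"
    by (intro finite_measure_mono) auto
  also have "\<dots> \<le> C * exp (- v * r\<^sup>2)" using r(1) by (rule tail)
  also have "exp (- v * r\<^sup>2) = inverse (t\<^sup>2)"
    using \<open>1 < t\<close> by (simp add: r(2) exp_minus exp_double)
  finally show ?thesis .
qed

lemma subgaussian_integrable_exp_square:
  assumes "subgaussian M"
  obtains p where "0 < p" "integrable M (\<lambda>x. exp (p * x\<^sup>2))"
proof -
  obtain C v where C: "C > 0" and v: "v > 0"
    and tail: "\<And>t. t > 0 \<Longrightarrow> prob {x. \<bar>x\<bar> > t} \<le> C * exp (- v * t\<^sup>2)"
    using assms unfolding subgaussian_def by auto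
  define b where "b t = of_bool (t < 2) + C * inverse ((real t)\<^sup>2)" for t :: nat
  have layer: "prob {x. real t < exp (v / 2 * x\<^sup>2)} \<le> b t" for t
  proof (cases "t < 2")
    case True
    then show ?thesis using C prob_le_1 by (auto simp: b_def intro: order_trans add_increasing2)
  next
    case False
    then show ?thesis using prob_exp_square_gt_le[OF tail v, of "real t"] by (simp add: b_def)
  qed
  have "summable (\<lambda>t::nat. of_bool (t < 2) :: real)"
    by (rule summable_finite[of "{..<2}"]) auto
  then have b: "summable b" "0 \<le> b t" for t
    using C unfolding b_def by (auto intro!: summable_add summable_mult inverse_power_summable)
  have "(\<integral>\<^sup>+x. ennreal (exp (v / 2 * x\<^sup>2)) \<partial>M) \<le> (\<integral>\<^sup>+x. of_nat (nat \<lceil>exp (v / 2 * x\<^sup>2)\<rceil>) \<partial>M)"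
    by (intro nn_integral_mono) (simp add: ennreal_of_nat_eq_real_of_nat ennreal_leI)
  also have "\<dots> = (\<Sum>t. emeasure M {x \<in> space M. t < nat \<lceil>exp (v / 2 * x\<^sup>2)\<rceil>})"
    by (intro nn_integral_nat_function) measurable
  also have "\<dots> = (\<Sum>t. ennreal (prob {x. real t < exp (v / 2 * x\<^sup>2)}))"
    by (simp add: emeasure_eq_measure zless_nat_eq_int_zless less_ceiling_iff)
  also have "\<dots> \<le> (\<Sum>t. ennreal (b t))"
    by (intro suminf_le ennreal_leI layer) auto
  also have "\<dots> < \<infinity>" using b by (simp add: suminf_ennreal2)
  finally have "integrable M (\<lambda>x. exp (v / 2 * x\<^sup>2))"
    by (intro integrableI_bounded) auto
  with v show thesis by (intro that[of "v / 2"]) auto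
qed

lemma mgf_le_centered:
  assumes exp_square: "integrable M (\<lambda>x. exp (p * x\<^sup>2))" and p: "0 < p"
    and mean: "integrable M (\<lambda>x. x)" "(\<integral>x. x \<partial>M) = 0" and s: "s\<^sup>2 \<le> p"
  shows "(\<integral>\<^sup>+x. ennreal (exp (s * x)) \<partial>M) \<le> ennreal (exp (s\<^sup>2 / p * ((\<integral>x. exp (p * x\<^sup>2) \<partial>M) - 1)))"
proof -
  define l where "l = s\<^sup>2 / p"
  have l: "0 \<le> l" "l \<le> 1" "s\<^sup>2 = l * p" using s p by (auto simp: l_def)
  let ?g = "\<lambda>x. s * x + (1 + l * (exp (p * x\<^sup>2) - 1))"
  have chord: "exp (s * x) \<le> ?g x" for x
  proof -
    have "exp ((1 - l) *\<^sub>R 0 + l *\<^sub>R (p * x\<^sup>2)) \<le> (1 - l) * exp 0 + l * exp (p * x\<^sup>2)"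
      using l by (intro convex_onD[OF exp_convex]) auto
    moreover have "exp (s * x) \<le> s * x + exp (l * (p * x\<^sup>2))"
      using exp_le_add_exp_square[of "s * x"] l(3) by (simp add: power_mult_distrib mult.assoc)
    ultimately show ?thesis by (simp add: algebra_simps)
  qed
  have "(\<integral>\<^sup>+x. ennreal (exp (s * x)) \<partial>M) \<le> (\<integral>\<^sup>+x. ennreal (?g x) \<partial>M)"
    by (intro nn_integral_mono ennreal_leI chord)
  also have "\<dots> = ennreal (\<integral>x. ?g x \<partial>M)"
    using exp_square mean(1)
    by (intro nn_integral_eq_integral AE_I2 order_trans[OF exp_ge_zero chord]) auto
  also have "(\<integral>x. ?g x \<partial>M) = 1 + l * ((\<integral>x. exp (p * x\<^sup>2) \<partial>M) - 1)"
    using exp_square mean prob_space by simp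
  also have "\<dots> \<le> exp (l * ((\<integral>x. exp (p * x\<^sup>2) \<partial>M) - 1))" by simp
  finally show ?thesis by (simp add: l_def ennreal_leI)
qed

lemma mgf_le_exp_square:
  assumes exp_square: "integrable M (\<lambda>x. exp (p * x\<^sup>2))" and p: "0 < p"
  shows "(\<integral>\<^sup>+x. ennreal (exp (s * x)) \<partial>M) \<le> ennreal (exp (s\<^sup>2 / (4 * p)) * (\<integral>x. exp (p * x\<^sup>2) \<partial>M))"
proof -
  have "exp (s * x) \<le> exp (s\<^sup>2 / (4 * p)) * exp (p * x\<^sup>2)" for x
  proof -
    have "s\<^sup>2 / (4 * p) + p * x\<^sup>2 - s * x = (s - 2 * p * x)\<^sup>2 / (4 * p)"
      using p by (simp add: field_simps power2_eq_square)
    also have "\<dots> \<ge> 0" using p by simp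
    finally show ?thesis by (simp flip: exp_add)
  qed
  then have "(\<integral>\<^sup>+x. ennreal (exp (s * x)) \<partial>M) \<le> (\<integral>\<^sup>+x. ennreal (exp (s\<^sup>2 / (4 * p)) * exp (p * x\<^sup>2)) \<partial>M)"
    by (intro nn_integral_mono ennreal_leI)
  also have "\<dots> = ennreal (\<integral>x. exp (s\<^sup>2 / (4 * p)) * exp (p * x\<^sup>2) \<partial>M)"
    using exp_square by (intro nn_integral_eq_integral) auto
  finally show ?thesis by simp
qed

lemma subgaussian_variance_proxy:
  assumes "subgaussian M" "integrable M (\<lambda>x. x)" "(\<integral>x. x \<partial>M) = 0"
  obtains V where "variance_proxy M V"
proof -
  obtain p where p: "0 < p" and exp_square: "integrable M (\<lambda>x. exp (p * x\<^sup>2))"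
    using subgaussian_integrable_exp_square[OF assms(1)] .
  define B where "B = (\<integral>x. exp (p * x\<^sup>2) \<partial>M)"
  have "(\<integral>x. 1 \<partial>M) \<le> B" unfolding B_def using exp_square p by (intro integral_mono) auto
  then have B: "1 \<le> B" using prob_space by simp
  define V where "V = 2 * (1 + B) / p"
  have V: "V * s\<^sup>2 / 2 = s\<^sup>2 / p + s\<^sup>2 / p * B" for s by (simp add: V_def algebra_simps add_divide_distrib)
  have "(\<integral>\<^sup>+x. ennreal (exp (s * x)) \<partial>M) \<le> ennreal (exp (V * s\<^sup>2 / 2))" for s
  proof (cases "s\<^sup>2 \<le> p")
    case True
    have "s\<^sup>2 / p * (B - 1) \<le> V * s\<^sup>2 / 2" using p unfolding V by (simp add: right_diff_distrib)
    then have "ennreal (exp (s\<^sup>2 / p * (B - 1))) \<le> ennreal (exp (V * s\<^sup>2 / 2))"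
      by (intro ennreal_leI) simp
    with mgf_le_centered[OF exp_square p assms(2,3) True, folded B_def] show ?thesis
      by (rule order_trans)
  next
    case False
    have "1 * B \<le> s\<^sup>2 / p * B" using False p B by (intro mult_right_mono) auto
    then have "B \<le> exp (s\<^sup>2 / p * B)" using exp_ge_add_one_self[of "s\<^sup>2 / p * B"] by linarith
    moreover have "s\<^sup>2 / (4 * p) \<le> s\<^sup>2 / p" using p by (intro divide_left_mono) auto
    ultimately have "exp (s\<^sup>2 / (4 * p)) * B \<le> exp (s\<^sup>2 / p) * exp (s\<^sup>2 / p * B)"
      using B by (intro mult_mono) auto
    also have "\<dots> = exp (V * s\<^sup>2 / 2)" by (simp only: V exp_add)
    finally show ?thesis
      using mgf_le_exp_square[OF exp_square p, of s] by (auto simp: B_def intro: order_trans ennreal_leI)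
  qed
  moreover have "0 \<le> V" using p B by (simp add: V_def)
  ultimately show thesis using that by (auto simp: variance_proxy_def)
qed

end

section \<open>Distance to the integer lattice\<close>

lemma vnorm_L2_set: "vnorm n a = L2_set a {..<n}"
  by (simp add: vnorm_def L2_set_def)

lemma vnorm_nonneg [simp]: "0 \<le> vnorm n a"
  by (simp add: vnorm_L2_set)

lemma vnorm_power2: "(vnorm n a)\<^sup>2 = (\<Sum>j<n. (a j)\<^sup>2)"
  by (simp add: vnorm_def sum_nonneg)

lemma vnorm_triangle: "vnorm n (\<lambda>j. a j + b j) \<le> vnorm n a + vnorm n b"
  unfolding vnorm_L2_set by (rule L2_set_triangle_ineq)

lemma vnorm_scale: "vnorm n (\<lambda>j. c * a j) = \<bar>c\<bar> * vnorm n a"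
  by (simp add: vnorm_def power_mult_distrib real_sqrt_mult flip: sum_distrib_left)

lemma vnorm_divide: "vnorm n (\<lambda>j. a j / c) = vnorm n a / \<bar>c\<bar>"
  using vnorm_scale[of n "1 / c" a] by simp

lemma vnorm_minus_commute: "vnorm n (\<lambda>j. a j - b j) = vnorm n (\<lambda>j. b j - a j)"
  by (simp add: vnorm_def power2_commute)

lemma vnorm_triangle_diff: "vnorm n (\<lambda>j. a j - b j) \<le> vnorm n a + vnorm n b"
  using vnorm_triangle[of n a "\<lambda>j. - b j"] by (simp add: vnorm_def)

lemma vnorm_mono: "(\<And>j. j < n \<Longrightarrow> \<bar>a j\<bar> \<le> \<bar>b j\<bar>) \<Longrightarrow> vnorm n a \<le> vnorm n b"
  unfolding vnorm_def by (intro real_sqrt_le_mono sum_mono) (simp add: abs_le_square_iff)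

lemma vnorm_cong: "(\<And>j. j < n \<Longrightarrow> a j = b j) \<Longrightarrow> vnorm n a = vnorm n b"
  by (simp add: vnorm_def)

lemma abs_component_le_vnorm:
  assumes "j < n"
  shows "\<bar>a j\<bar> \<le> vnorm n a"
  using member_le_L2_set[of "{..<n}" j "\<lambda>j. \<bar>a j\<bar>"] assms by (simp add: vnorm_L2_set L2_set_def)

lemma sum_abs_le_vnorm: "(\<Sum>j<n. \<bar>a j\<bar>) \<le> sqrt (real n) * vnorm n a"
  using L2_set_mult_ineq[of "\<lambda>_. 1" a "{..<n}"] by (simp add: vnorm_L2_set L2_set_constant)

lemma vnorm_diff_normalize_le:
  assumes unit: "vnorm n z = 1" and "0 < \<theta>" and p: "0 < vnorm n p"
  shows "\<theta> * vnorm n (\<lambda>j. z j - p j / vnorm n p) \<le> 2 * vnorm n (\<lambda>j. \<theta> * z j - p j)"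
proof -
  define d where "d = vnorm n (\<lambda>j. \<theta> * z j - p j)"
  define r where "r = vnorm n p"
  have r: "0 < r" using p by (simp add: r_def)
  have \<theta>: "vnorm n (\<lambda>j. \<theta> * z j) = \<theta>" using unit \<open>0 < \<theta>\<close> by (simp add: vnorm_scale)
  have "\<theta> \<le> d + r"
    using vnorm_triangle[of n "\<lambda>j. \<theta> * z j - p j" p] by (simp add: \<theta> r_def d_def)
  moreover have "r \<le> \<theta> + d"
    using vnorm_triangle_diff[of n "\<lambda>j. \<theta> * z j" "\<lambda>j. \<theta> * z j - p j"] by (simp add: \<theta> r_def d_def)
  ultimately have norm_close: "\<bar>r - \<theta>\<bar> \<le> d" by linarith
  have "\<theta> * vnorm n (\<lambda>j. z j - p j / r) = vnorm n (\<lambda>j. \<theta> * (z j - p j / r))"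
    using \<open>0 < \<theta>\<close> by (simp add: vnorm_scale)
  also have "\<dots> = vnorm n (\<lambda>j. (\<theta> * z j - p j) + ((r - \<theta>) / r) * p j)"
    using r by (intro vnorm_cong) (simp add: field_simps)
  also have "\<dots> \<le> d + vnorm n (\<lambda>j. ((r - \<theta>) / r) * p j)"
    unfolding d_def by (rule vnorm_triangle)
  also have "vnorm n (\<lambda>j. ((r - \<theta>) / r) * p j) = \<bar>r - \<theta>\<bar>"
    unfolding vnorm_scale using r by (simp add: r_def)
  finally show ?thesis using norm_close by (simp add: r_def d_def)
qed

lemma dist_lattice_eq_round: "dist_lattice n a = vnorm n (\<lambda>j. a j - of_int (round (a j)))"
  unfolding dist_lattice_def
proof (rule cInf_eq_minimum)
  fix x assume "x \<in> {vnorm n (\<lambda>j. a j - real_of_int (p j)) |p. True}"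
  then obtain p :: "nat \<Rightarrow> int" where "x = vnorm n (\<lambda>j. a j - real_of_int (p j))" by auto
  then show "vnorm n (\<lambda>j. a j - of_int (round (a j))) \<le> x"
    by (auto intro!: vnorm_mono round_diff_minimal)
qed auto

lemma dist_lattice_le: "dist_lattice n a \<le> vnorm n (\<lambda>j. a j - of_int (p j))"
  unfolding dist_lattice_eq_round by (auto intro!: vnorm_mono round_diff_minimal)

lemma dist_lattice_le_half_sqrt: "dist_lattice n a \<le> sqrt (real n) / 2"
proof -
  have "dist_lattice n a \<le> vnorm n (\<lambda>j. 1 / 2)"
    unfolding dist_lattice_eq_round
    using of_int_round_abs_le[of "a _"] by (intro vnorm_mono) (simp add: abs_minus_commute)
  also have "\<dots> = sqrt (real n) / 2"
    by (simp add: vnorm_def power2_eq_square real_sqrt_divide)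
  finally show ?thesis .
qed

lemma dist_lattice_diff: "dist_lattice n (\<lambda>j. a j - b j) \<le> dist_lattice n a + dist_lattice n b"
proof -
  have "dist_lattice n (\<lambda>j. a j - b j) \<le> vnorm n (\<lambda>j. a j - b j - of_int (round (a j) - round (b j)))"
    by (rule dist_lattice_le)
  also have "\<dots> = vnorm n (\<lambda>j. (a j - of_int (round (a j))) - (b j - of_int (round (b j))))"
    by (intro vnorm_cong) simp
  also have "\<dots> \<le> dist_lattice n a + dist_lattice n b"
    unfolding dist_lattice_eq_round by (rule vnorm_triangle_diff)
  finally show ?thesis .
qed

lemma dist_lattice_le_add_vnorm: "dist_lattice n a \<le> dist_lattice n b + vnorm n (\<lambda>j. a j - b j)"
proof -
  have "dist_lattice n a \<le> vnorm n (\<lambda>j. a j - of_int (round (b j)))"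
    by (rule dist_lattice_le)
  also have "\<dots> = vnorm n (\<lambda>j. (b j - of_int (round (b j))) + (a j - b j))"
    by (intro vnorm_cong) simp
  also have "\<dots> \<le> dist_lattice n b + vnorm n (\<lambda>j. a j - b j)"
    unfolding dist_lattice_eq_round by (rule vnorm_triangle)
  finally show ?thesis .
qed

lemma dist_lattice_lipschitz: "(vnorm n x)-lipschitz_on UNIV (\<lambda>v. dist_lattice n (\<lambda>j. v * x j))"
proof (rule lipschitz_onI)
  fix v w :: real
  have le: "dist_lattice n (\<lambda>j. v * x j) \<le> dist_lattice n (\<lambda>j. w * x j) + \<bar>v - w\<bar> * vnorm n x" for v w
    using dist_lattice_le_add_vnorm[of n "\<lambda>j. v * x j" "\<lambda>j. w * x j"] vnorm_scale[of n "v - w" x]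
    by (simp add: left_diff_distrib)
  show "dist (dist_lattice n (\<lambda>j. v * x j)) (dist_lattice n (\<lambda>j. w * x j)) \<le> vnorm n x * dist v w"
    using le[of v w] le[of w v] by (simp add: dist_real_def abs_minus_commute[of w v] mult.commute)
qed simp

lemma continuous_on_dist_lattice: "continuous_on S (\<lambda>v. dist_lattice n (\<lambda>j. v * x j))"
  using lipschitz_on_continuous_on[OF dist_lattice_lipschitz] by (rule continuous_on_subset) simp

lemma borel_measurable_dist_lattice:
  "f \<in> borel_measurable N \<Longrightarrow> (\<lambda>w. dist_lattice n (\<lambda>j. f w * x j)) \<in> borel_measurable N"
  by (rule measurable_compose[OF _ borel_measurable_continuous_onI[OF continuous_on_dist_lattice]])

lemma dist_lattice_power2_le_cos:
  "(dist_lattice n a)\<^sup>2 \<le> (\<Sum>j<n. 1 - cos (2 * pi * a j))"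
proof -
  have "(a j - of_int (round (a j)))\<^sup>2 \<le> 1 - cos (2 * pi * a j)" for j
  proof -
    define y where "y = 2 * pi * (a j - of_int (round (a j)))"
    have "\<bar>a j - of_int (round (a j))\<bar> \<le> 1 / 2"
      using of_int_round_abs_le[of "a j"] by (simp add: abs_minus_commute)
    then have "\<bar>y\<bar> \<le> pi" by (simp add: y_def abs_mult)
    then have "y\<^sup>2 / 12 \<le> 1 - cos y" by (rule square_div_12_le_one_minus_cos)
    moreover have "cos y = cos (2 * pi * a j)"
      using sin_int_2pin[of "round (a j)"] cos_int_2pin[of "round (a j)"]
      by (simp add: y_def right_diff_distrib cos_diff)
    moreover have "6\<^sup>2 \<le> (2 * pi)\<^sup>2" using pi_gt3 by (intro power_mono) auto
    then have "12 * (a j - of_int (round (a j)))\<^sup>2 \<le> y\<^sup>2"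
      unfolding y_def power_mult_distrib[of "2 * pi"] by (intro mult_right_mono) auto
    ultimately show ?thesis by linarith
  qed
  then show ?thesis unfolding dist_lattice_eq_round vnorm_power2 by (intro sum_mono)
qed

lemma LCD_less_iff:
  "LCD n \<gamma> \<alpha> a < ereal D \<longleftrightarrow>
    (\<exists>\<theta>. 0 < \<theta> \<and> \<theta> < D \<and> dist_lattice n (\<lambda>j. \<theta> * a j) < min (\<gamma> * vnorm n (\<lambda>j. \<theta> * a j)) \<alpha>)"
  unfolding LCD_def by (auto simp: INF_less_iff)

lemma min_le_dist_lattice:
  assumes "vnorm n x = 1" and LCD: "ereal D \<le> LCD n \<gamma> \<alpha> x" and v: "\<bar>v\<bar> < D"
  shows "min (\<gamma> * \<bar>v\<bar>) \<alpha> \<le> dist_lattice n (\<lambda>j. v * x j)"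
proof -
  have pos: "min (\<gamma> * \<theta>) \<alpha> \<le> dist_lattice n (\<lambda>j. \<theta> * x j)" if "0 < \<theta>" "\<theta> < D" for \<theta>
    using LCD_less_iff[of n \<gamma> \<alpha> x D] LCD that \<open>vnorm n x = 1\<close> by (force simp: not_less vnorm_scale)
  consider "v = 0" | "0 < v" | "v < 0" by linarith
  then show ?thesis
  proof cases
    case 3
    then have "min (\<gamma> * \<bar>v\<bar>) \<alpha> \<le> dist_lattice n (\<lambda>j. 0 - v * x j)"
      using pos[of "- v"] v by simp
    also have "\<dots> \<le> dist_lattice n (\<lambda>_. 0) + dist_lattice n (\<lambda>j. v * x j)"
      by (rule dist_lattice_diff)
    finally show ?thesis by (simp add: dist_lattice_eq_round vnorm_def)
  qed (use pos v in \<open>auto simp: min_le_iff_disj dist_lattice_eq_round\<close>)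
qed

lemma exp_minus_square_le_of_min_le:
  fixes v y \<gamma> \<alpha> \<kappa> :: real
  assumes le: "min (\<gamma> * \<bar>v\<bar>) \<alpha> \<le> 2 * y" and pos: "0 < \<gamma>" "0 < \<alpha>" "0 < \<kappa>"
  shows "exp (- \<kappa> * y\<^sup>2) \<le> exp (- (\<kappa> * \<gamma>\<^sup>2 / 4 * v\<^sup>2)) + exp (- \<kappa> * \<alpha>\<^sup>2 / 4)"
proof -
  let ?m = "min (\<gamma> * \<bar>v\<bar>) \<alpha>"
  have "?m\<^sup>2 \<le> (2 * y)\<^sup>2" using le pos by (intro power_mono) auto
  then have "- \<kappa> * y\<^sup>2 \<le> - \<kappa> * ?m\<^sup>2 / 4" using pos by (simp add: power_mult_distrib)
  then have "exp (- \<kappa> * y\<^sup>2) \<le> exp (- \<kappa> * ?m\<^sup>2 / 4)" by (simp only: exp_le_cancel_iff)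
  also have "\<dots> \<le> exp (- \<kappa> * (\<gamma> * \<bar>v\<bar>)\<^sup>2 / 4) + exp (- \<kappa> * \<alpha>\<^sup>2 / 4)"
    by (simp add: min_def)
  finally show ?thesis by (simp add: power_mult_distrib mult.assoc)
qed

text \<open>If \<open>g\<close> grows linearly near \<open>0\<close> and is subadditive, then it also grows linearly away from a
  minimiser \<open>u\<^sub>0\<close> in any short interval, because \<open>g (u - u\<^sub>0) \<le> g u + g u\<^sub>0 \<le> 2 * g u\<close>.\<close>

lemma nn_integral_exp_subadditive_interval:
  fixes g :: "real \<Rightarrow> real"
  assumes cont: "continuous_on UNIV g" and subadditive: "\<And>v w. g (v - w) \<le> g v + g w"
    and growth: "\<And>v. \<bar>v\<bar> < D \<Longrightarrow> min (\<gamma> * \<bar>v\<bar>) \<alpha> \<le> g v"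
    and pos: "0 < \<gamma>" "0 < \<alpha>" "0 < \<kappa>" and l: "0 \<le> l" "l < D"
  shows "(\<integral>\<^sup>+u. ennreal (exp (- \<kappa> * (g u)\<^sup>2)) * indicator {s..s + l} u \<partial>lborel)
    \<le> ennreal (sqrt (4 * pi / \<kappa>) / \<gamma> + l * exp (- \<kappa> * \<alpha>\<^sup>2 / 4))"
proof -
  let ?J = "{s..s + l}"
  obtain u\<^sub>0 where u\<^sub>0: "u\<^sub>0 \<in> ?J" "\<And>u. u \<in> ?J \<Longrightarrow> g u\<^sub>0 \<le> g u"
    using continuous_attains_inf[of ?J g] l(1) continuous_on_subset[OF cont] by auto
  define a where "a = \<kappa> * \<gamma>\<^sup>2 / 4"
  have a: "0 < a" using pos by (simp add: a_def)
  have gaussian: "exp (- \<kappa> * (g u)\<^sup>2) \<le> exp (- (a * (u - u\<^sub>0)\<^sup>2)) + exp (- \<kappa> * \<alpha>\<^sup>2 / 4)"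
    if u: "u \<in> ?J" for u
    unfolding a_def
  proof (rule exp_minus_square_le_of_min_le[OF _ pos])
    have "min (\<gamma> * \<bar>u - u\<^sub>0\<bar>) \<alpha> \<le> g (u - u\<^sub>0)" using u u\<^sub>0(1) l by (intro growth) auto
    also have "\<dots> \<le> 2 * g u" using subadditive[of u u\<^sub>0] u\<^sub>0(2)[OF u] by linarith
    finally show "min (\<gamma> * \<bar>u - u\<^sub>0\<bar>) \<alpha> \<le> 2 * g u" .
  qed
  let ?h = "\<lambda>u. ennreal (exp (- (a * (u - u\<^sub>0)\<^sup>2))) + ennreal (exp (- \<kappa> * \<alpha>\<^sup>2 / 4)) * indicator ?J u"
  have "(\<integral>\<^sup>+u. ennreal (exp (- \<kappa> * (g u)\<^sup>2)) * indicator ?J u \<partial>lborel) \<le> (\<integral>\<^sup>+u. ?h u \<partial>lborel)"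
  proof (rule nn_integral_mono)
    fix u :: real
    show "ennreal (exp (- \<kappa> * (g u)\<^sup>2)) * indicator ?J u \<le> ?h u"
      using gaussian[of u] by (cases "u \<in> ?J") (auto simp: ennreal_leI simp flip: ennreal_plus)
  qed
  also have "\<dots> = ennreal (sqrt (pi / a)) + ennreal (exp (- \<kappa> * \<alpha>\<^sup>2 / 4)) * ennreal l"
    using l(1) by (simp add: nn_integral_add nn_integral_gaussian[OF a] nn_integral_cmult_indicator)
  also have "\<dots> = ennreal (sqrt (pi / a) + l * exp (- \<kappa> * \<alpha>\<^sup>2 / 4))"
    using l(1) a by (simp add: mult.commute flip: ennreal_plus ennreal_mult)
  also have "pi / a = (4 * pi / \<kappa>) / \<gamma>\<^sup>2" by (simp add: a_def)
  then have "sqrt (pi / a) = sqrt (4 * pi / \<kappa>) / \<gamma>" using pos by (simp add: real_sqrt_divide real_sqrt_mult)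
  finally show ?thesis .
qed

section \<open>Counting integer vectors\<close>

definition int_l1_ball :: "nat \<Rightarrow> real \<Rightarrow> (nat \<Rightarrow> int) set" where
  "int_l1_ball n \<rho> = {p \<in> {..<n} \<rightarrow>\<^sub>E UNIV. (\<Sum>j<n. \<bar>real_of_int (p j)\<bar>) \<le> \<rho>}"

definition int_ball :: "nat \<Rightarrow> real \<Rightarrow> (nat \<Rightarrow> int) set" where
  "int_ball n \<rho> = {p \<in> {..<n} \<rightarrow>\<^sub>E UNIV. vnorm n (\<lambda>j. real_of_int (p j)) \<le> \<rho>}"

lemma sum_exp_abs_int_le:
  fixes s :: real
  assumes "0 < s"
  shows "(\<Sum>k\<in>{- int N..int N}. exp (- s * \<bar>of_int k\<bar>)) \<le> 1 + 2 / s"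
proof -
  define r where "r = exp (- s)"
  have r: "0 < r" "r * (exp s - 1) = 1 - r" "0 < exp s - 1"
    using assms by (auto simp: r_def algebra_simps simp flip: exp_add)
  have "(\<Sum>k\<in>{- int N..int N}. exp (- s * \<bar>of_int k\<bar>)) = 1 + 2 * (1 - r ^ N) / (exp s - 1)"
  proof (induction N)
    case (Suc N)
    have "{- int (Suc N)..int (Suc N)} = insert (int (Suc N)) (insert (- int (Suc N)) {- int N..int N})" by auto
    then have "(\<Sum>k\<in>{- int (Suc N)..int (Suc N)}. exp (- s * \<bar>of_int k\<bar>))
        = 2 * r ^ Suc N + (\<Sum>k\<in>{- int N..int N}. exp (- s * \<bar>of_int k\<bar>))"
      by (simp add: r_def algebra_simps flip: exp_of_nat_mult exp_add)
    also have "\<dots> = 2 * (r ^ N * (r * (exp s - 1))) / (exp s - 1) + (1 + 2 * (1 - r ^ N) / (exp s - 1))"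
      using Suc.IH r(3) by simp
    also have "\<dots> = 1 + 2 * (1 - r ^ Suc N) / (exp s - 1)"
      unfolding r(2) by (simp add: add_divide_distrib diff_divide_distrib algebra_simps)
    finally show ?case .
  qed simp
  also have "2 * (1 - r ^ N) / (exp s - 1) \<le> 2 / s"
    using r assms exp_ge_add_one_self[of s] by (intro frac_le) (auto simp del: exp_ge_add_one_self)
  finally show ?thesis by simp
qed

lemma int_l1_ball_subset_box: "int_l1_ball n \<rho> \<subseteq> {..<n} \<rightarrow>\<^sub>E {- int (nat \<lfloor>\<rho>\<rfloor>)..int (nat \<lfloor>\<rho>\<rfloor>)}"
proof
  fix p assume p: "p \<in> int_l1_ball n \<rho>"
  have "p j \<in> {- int (nat \<lfloor>\<rho>\<rfloor>)..int (nat \<lfloor>\<rho>\<rfloor>)}" if "j < n" for j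
  proof -
    have "\<bar>real_of_int (p j)\<bar> \<le> (\<Sum>j<n. \<bar>real_of_int (p j)\<bar>)"
      using that by (intro member_le_sum) auto
    then have "\<bar>p j\<bar> \<le> \<lfloor>\<rho>\<rfloor>" using p by (simp add: int_l1_ball_def le_floor_iff)
    then have "\<bar>p j\<bar> \<le> int (nat \<lfloor>\<rho>\<rfloor>)" by linarith
    then show ?thesis unfolding atLeastAtMost_iff abs_le_iff by linarith
  qed
  then show "p \<in> {..<n} \<rightarrow>\<^sub>E {- int (nat \<lfloor>\<rho>\<rfloor>)..int (nat \<lfloor>\<rho>\<rfloor>)}"
    using p by (auto simp: int_l1_ball_def PiE_iff)
qed

lemma finite_int_l1_ball: "finite (int_l1_ball n \<rho>)"
  using int_l1_ball_subset_box by (rule finite_subset) (simp add: finite_PiE)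

text \<open>Exponential Markov inequality for the counting measure.\<close>

lemma card_int_l1_ball_le:
  assumes "0 < s"
  shows "real (card (int_l1_ball n \<rho>)) \<le> exp (s * \<rho>) * (1 + 2 / s) ^ n"
proof -
  let ?B = "{- int (nat \<lfloor>\<rho>\<rfloor>)..int (nat \<lfloor>\<rho>\<rfloor>)}"
  let ?w = "\<lambda>p. \<Prod>j<n. exp (- s * \<bar>of_int (p j)\<bar>)"
  have "real (card (int_l1_ball n \<rho>)) = (\<Sum>p\<in>int_l1_ball n \<rho>. 1)" by simp
  also have "\<dots> \<le> (\<Sum>p\<in>int_l1_ball n \<rho>. exp (s * \<rho>) * ?w p)"
  proof (rule sum_mono)
    fix p assume "p \<in> int_l1_ball n \<rho>"
    then have "s * (\<Sum>j<n. \<bar>real_of_int (p j)\<bar>) \<le> s * \<rho>"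
      using assms by (intro mult_left_mono) (auto simp: int_l1_ball_def)
    then have "1 \<le> exp (s * \<rho> + (\<Sum>j<n. - s * \<bar>of_int (p j)\<bar>))"
      by (simp add: sum_negf sum_distrib_left)
    then show "1 \<le> exp (s * \<rho>) * ?w p"
      by (simp add: exp_add exp_sum)
  qed
  also have "\<dots> \<le> (\<Sum>p\<in>{..<n} \<rightarrow>\<^sub>E ?B. exp (s * \<rho>) * ?w p)"
    using int_l1_ball_subset_box
    by (intro sum_mono2) (auto intro!: finite_PiE mult_nonneg_nonneg prod_nonneg)
  also have "\<dots> = exp (s * \<rho>) * (\<Prod>j<n. \<Sum>k\<in>?B. exp (- s * \<bar>of_int k\<bar>))"
    by (subst prod_sum_PiE) (simp_all add: sum_distrib_left)
  also have "\<dots> \<le> exp (s * \<rho>) * (\<Prod>j<n. 1 + 2 / s)"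
    using assms by (intro mult_left_mono prod_mono conjI sum_nonneg sum_exp_abs_int_le) auto
  finally show ?thesis by simp
qed

lemma int_ball_subset_l1_ball_sqrt: "int_ball n \<rho> \<subseteq> int_l1_ball n (sqrt (real n) * \<rho>)"
proof
  fix p assume "p \<in> int_ball n \<rho>"
  then have p: "p \<in> {..<n} \<rightarrow>\<^sub>E UNIV" "vnorm n (\<lambda>j. of_int (p j)) \<le> \<rho>" by (auto simp: int_ball_def)
  have "(\<Sum>j<n. \<bar>real_of_int (p j)\<bar>) \<le> sqrt (real n) * vnorm n (\<lambda>j. of_int (p j))"
    by (rule sum_abs_le_vnorm)
  also have "\<dots> \<le> sqrt (real n) * \<rho>" using p(2) by (intro mult_left_mono) auto
  finally show "p \<in> int_l1_ball n (sqrt (real n) * \<rho>)" using p(1) by (simp add: int_l1_ball_def)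
qed

lemma int_ball_subset_l1_ball_power2: "int_ball n \<rho> \<subseteq> int_l1_ball n (\<rho>\<^sup>2)"
proof
  fix p assume "p \<in> int_ball n \<rho>"
  then have p: "p \<in> {..<n} \<rightarrow>\<^sub>E UNIV" "vnorm n (\<lambda>j. of_int (p j)) \<le> \<rho>" by (auto simp: int_ball_def)
  have "\<bar>k\<bar> \<le> k\<^sup>2" for k :: int
    using self_le_power[of "\<bar>k\<bar>" 2] by (cases "k = 0") auto
  then have "\<bar>real_of_int k\<bar> \<le> (real_of_int k)\<^sup>2" for k
    by (metis of_int_abs of_int_le_iff of_int_power)
  then have "(\<Sum>j<n. \<bar>real_of_int (p j)\<bar>) \<le> (vnorm n (\<lambda>j. of_int (p j)))\<^sup>2"
    unfolding vnorm_power2 by (rule sum_mono)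
  also have "\<dots> \<le> \<rho>\<^sup>2" using p(2) by (intro power_mono) auto
  finally show "p \<in> int_l1_ball n (\<rho>\<^sup>2)" using p(1) by (simp add: int_l1_ball_def)
qed

lemma finite_int_ball: "finite (int_ball n \<rho>)"
  using int_ball_subset_l1_ball_sqrt finite_int_l1_ball by (rule finite_subset)

lemma card_int_ball_le_sqrt:
  assumes "0 < s"
  shows "real (card (int_ball n \<rho>)) \<le> exp (s * (sqrt (real n) * \<rho>)) * (1 + 2 / s) ^ n"
  using card_mono[OF finite_int_l1_ball int_ball_subset_l1_ball_sqrt[of n \<rho>]]
  by (intro order_trans[OF _ card_int_l1_ball_le[OF assms]]) simp

lemma card_int_ball_le_power2:
  assumes "0 < s"
  shows "real (card (int_ball n \<rho>)) \<le> exp (s * \<rho>\<^sup>2) * (1 + 2 / s) ^ n"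
  using card_mono[OF finite_int_l1_ball int_ball_subset_l1_ball_power2[of n \<rho>]]
  by (intro order_trans[OF _ card_int_l1_ball_le[OF assms]]) simp

lemma card_int_ball_mult_le_exp:
  assumes "m \<le> n"
  shows "real (card (int_ball n (5 / 2 * sqrt (real n)))) * (exp (- (6 * real n)) * 2 ^ m) \<le> exp (- real n)"
proof -
  have "(3::real) \<le> (1 + 3 / 4)\<^sup>2" by (simp add: power2_eq_square)
  also have "\<dots> \<le> (exp (3 / 4))\<^sup>2" by (intro power_mono exp_ge_add_one_self) auto
  also have "\<dots> = exp (3 / 2 :: real)" by (simp add: power2_eq_square flip: exp_add)
  finally have three: "(3::real) ^ n \<le> exp (3 / 2) ^ n" by (intro power_mono) auto
  have "(2::real) ^ m \<le> 2 ^ n" using assms by (intro power_increasing) auto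
  also have "\<dots> \<le> exp 1 ^ n" using exp_ge_add_one_self[of 1] by (intro power_mono) auto
  finally have two: "(2::real) ^ m \<le> exp 1 ^ n" .
  have exponent: "1 * (sqrt (real n) * (5 / 2 * sqrt (real n))) = 5 / 2 * real n" by simp
  have "real (card (int_ball n (5 / 2 * sqrt (real n)))) \<le> exp (5 / 2 * real n) * (1 + 2 / 1) ^ n"
    using card_int_ball_le_sqrt[of 1 n "5 / 2 * sqrt (real n)"] unfolding exponent by simp
  then have "real (card (int_ball n (5 / 2 * sqrt (real n)))) * (exp (- (6 * real n)) * 2 ^ m)
      \<le> (exp (5 / 2 * real n) * exp (3 / 2) ^ n) * (exp (- (6 * real n)) * exp 1 ^ n)"
    using two by (intro mult_mono order_trans[OF _ mult_left_mono[OF three]]) auto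
  also have "\<dots> = exp (- real n)"
    by (simp add: algebra_simps flip: exp_of_nat_mult exp_add)
  finally show ?thesis .
qed

lemma card_small_int_ball_le_exp:
  assumes "0 < \<delta>"
  shows "real (card (int_ball n (\<delta> / 2 * sqrt (real n)))) \<le> exp (2 * \<delta> * real n)"
proof -
  have "real (card (int_ball n (\<delta> / 2 * sqrt (real n))))
      \<le> exp (2 / \<delta> * (\<delta> / 2 * sqrt (real n))\<^sup>2) * (1 + 2 / (2 / \<delta>)) ^ n"
    using assms by (intro card_int_ball_le_power2) simp
  also have "\<dots> = exp (\<delta> / 2 * real n) * (1 + \<delta>) ^ n"
    using assms by (simp add: power_mult_distrib power2_eq_square)
  also have "\<dots> \<le> exp (\<delta> * real n) * exp \<delta> ^ n"
    using assms by (intro mult_mono power_mono exp_ge_add_one_self) auto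
  also have "\<dots> = exp (2 * \<delta> * real n)" by (simp add: algebra_simps flip: exp_of_nat_mult exp_add)
  finally show ?thesis .
qed

section \<open>Nets\<close>

text \<open>Vectors with a common label are close to each other, so one representative for each label
  suffices.\<close>

lemma finite_net_of_labels:
  assumes "finite P" and label: "\<And>z. z \<in> S \<Longrightarrow> \<exists>p\<in>P. vnorm n (\<lambda>j. z j - c p j) \<le> \<epsilon>"
  obtains T where "T \<subseteq> S" "finite T" "card T \<le> card P" "\<And>z. z \<in> S \<Longrightarrow> \<exists>x\<in>T. vnorm n (\<lambda>j. z j - x j) \<le> 2 * \<epsilon>"
proof -
  define near where "near p z \<longleftrightarrow> z \<in> S \<and> vnorm n (\<lambda>j. z j - c p j) \<le> \<epsilon>" for p z
  define P' where "P' = {p \<in> P. \<exists>z. near p z}"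
  define rep where "rep p = (SOME z. near p z)" for p
  have rep: "near p (rep p)" if "p \<in> P'" for p
    unfolding rep_def using that by (intro someI_ex[of "near p"]) (auto simp: P'_def)
  have P': "finite P'" "P' \<subseteq> P" using \<open>finite P\<close> by (auto simp: P'_def)
  show thesis
  proof (rule that[of "rep ` P'"])
    show "rep ` P' \<subseteq> S" using rep by (auto simp: near_def)
    show "finite (rep ` P')" using P'(1) by simp
    show "card (rep ` P') \<le> card P"
      using card_image_le[OF P'(1), of rep] card_mono[OF \<open>finite P\<close> P'(2)] by simp
    fix z assume "z \<in> S"
    then obtain p where p: "p \<in> P" "near p z" using label by (auto simp: near_def)
    then have "p \<in> P'" by (auto simp: P'_def)
    have "vnorm n (\<lambda>j. z j - rep p j) = vnorm n (\<lambda>j. (z j - c p j) - (rep p j - c p j))" by simp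
    also have "\<dots> \<le> vnorm n (\<lambda>j. z j - c p j) + vnorm n (\<lambda>j. rep p j - c p j)"
      by (rule vnorm_triangle_diff)
    also have "\<dots> \<le> 2 * \<epsilon>" using p(2) rep[OF \<open>p \<in> P'\<close>] by (simp add: near_def)
    finally show "\<exists>x\<in>rep ` P'. vnorm n (\<lambda>j. z j - x j) \<le> 2 * \<epsilon>" using \<open>p \<in> P'\<close> by blast
  qed
qed

lemma dist_lattice_attained:
  obtains p :: "nat \<Rightarrow> int" where "p \<in> {..<n} \<rightarrow>\<^sub>E UNIV"
    "dist_lattice n a = vnorm n (\<lambda>j. a j - of_int (p j))"
proof (rule that[of "restrict (\<lambda>j. round (a j)) {..<n}"])
  show "dist_lattice n a = vnorm n (\<lambda>j. a j - of_int (restrict (\<lambda>j. round (a j)) {..<n} j))"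
    unfolding dist_lattice_eq_round by (intro vnorm_cong) simp
qed simp

lemma unit_vector_near_normalized_int_vector:
  assumes unit: "vnorm n z = 1" and \<theta>: "0 < \<theta>" "\<theta> < b"
    and near: "dist_lattice n (\<lambda>j. \<theta> * z j) < \<epsilon> * \<theta>" and "\<epsilon> \<le> 1"
  obtains p where "p \<in> int_ball n (2 * b)"
    "vnorm n (\<lambda>j. z j - of_int (p j) / vnorm n (\<lambda>j. of_int (p j))) \<le> 2 * \<epsilon>"
proof -
  obtain p :: "nat \<Rightarrow> int" where p: "p \<in> {..<n} \<rightarrow>\<^sub>E UNIV"
    and dist: "dist_lattice n (\<lambda>j. \<theta> * z j) = vnorm n (\<lambda>j. \<theta> * z j - of_int (p j))" (is "_ = ?d")
    by (rule dist_lattice_attained)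
  let ?r = "vnorm n (\<lambda>j. of_int (p j))"
  have norm_\<theta>: "vnorm n (\<lambda>j. \<theta> * z j) = \<theta>" using unit \<theta> by (simp add: vnorm_scale)
  have "\<epsilon> * \<theta> \<le> 1 * \<theta>" using \<open>\<epsilon> \<le> 1\<close> \<theta> by (intro mult_right_mono) auto
  then have "?d < \<theta>" using near dist by linarith
  moreover have "\<theta> \<le> ?d + ?r"
    using vnorm_triangle[of n "\<lambda>j. \<theta> * z j - of_int (p j)" "\<lambda>j. of_int (p j)"] by (simp add: norm_\<theta>)
  moreover have "?r \<le> \<theta> + ?d"
    using vnorm_triangle_diff[of n "\<lambda>j. \<theta> * z j" "\<lambda>j. \<theta> * z j - of_int (p j)"] by (simp add: norm_\<theta>)
  ultimately have r: "0 < ?r" "?r \<le> 2 * b" using \<theta>(2) by linarith+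
  have "\<theta> * vnorm n (\<lambda>j. z j - of_int (p j) / ?r) \<le> 2 * ?d"
    by (rule vnorm_diff_normalize_le[OF unit \<theta>(1) r(1)])
  also have "\<dots> \<le> \<theta> * (2 * \<epsilon>)" using near dist by (simp add: mult.commute)
  finally have "vnorm n (\<lambda>j. z j - of_int (p j) / ?r) \<le> 2 * \<epsilon>" using \<theta>(1) by simp
  with p r(2) show thesis by (intro that[of p]) (auto simp: int_ball_def)
qed

lemma finite_net_of_approximate_denominators:
  assumes S: "\<And>z. z \<in> S \<Longrightarrow> vnorm n z = 1"
      "\<And>z. z \<in> S \<Longrightarrow> \<exists>\<theta>. 0 < \<theta> \<and> \<theta> < b \<and> dist_lattice n (\<lambda>j. \<theta> * z j) < \<epsilon> * \<theta>"
    and "\<epsilon> \<le> 1"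
  obtains T where "T \<subseteq> S" "finite T" "card T \<le> card (int_ball n (2 * b))"
    "\<And>z. z \<in> S \<Longrightarrow> \<exists>x\<in>T. vnorm n (\<lambda>j. z j - x j) \<le> 4 * \<epsilon>"
proof -
  have "\<exists>p\<in>int_ball n (2 * b). vnorm n (\<lambda>j. z j - of_int (p j) / vnorm n (\<lambda>j. of_int (p j))) \<le> 2 * \<epsilon>"
    if "z \<in> S" for z
  proof -
    obtain \<theta> where \<theta>: "0 < \<theta>" "\<theta> < b" "dist_lattice n (\<lambda>j. \<theta> * z j) < \<epsilon> * \<theta>"
      using S(2)[OF \<open>z \<in> S\<close>] by blast
    show ?thesis
      by (rule unit_vector_near_normalized_int_vector[OF S(1)[OF \<open>z \<in> S\<close>] \<theta> \<open>\<epsilon> \<le> 1\<close>]) blast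
  qed
  from finite_net_of_labels[OF finite_int_ball this] show thesis using that by auto
qed

lemma approximate_denominator_of_LCD_less:
  assumes "vnorm n z = 1" "LCD n \<gamma> \<alpha> z < ereal b"
  obtains \<theta> where "0 < \<theta>" "\<theta> < b" "dist_lattice n (\<lambda>j. \<theta> * z j) < \<gamma> * \<theta>"
    "dist_lattice n (\<lambda>j. \<theta> * z j) < \<alpha>" "LCD n \<gamma> \<alpha> z \<le> ereal \<theta>"
proof -
  obtain \<theta> where \<theta>: "0 < \<theta>" "\<theta> < b" "dist_lattice n (\<lambda>j. \<theta> * z j) < min (\<gamma> * vnorm n (\<lambda>j. \<theta> * z j)) \<alpha>"
    using assms(2) by (auto simp: LCD_less_iff)
  moreover from this have "LCD n \<gamma> \<alpha> z \<le> ereal \<theta>"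
    unfolding LCD_def by (intro INF_lower) simp
  ultimately show thesis using assms(1) by (intro that) (auto simp: vnorm_scale)
qed

lemma approximate_denominator_of_LCD_level:
  assumes unit: "vnorm n z = 1" and LCD: "ereal D \<le> LCD n \<gamma> \<alpha> z" "LCD n \<gamma> \<alpha> z < ereal (2 * D)"
    and pos: "0 < D" "0 < \<alpha>"
  obtains \<theta> where "0 < \<theta>" "\<theta> < 2 * D" "dist_lattice n (\<lambda>j. \<theta> * z j) < min \<gamma> (\<alpha> / D) * \<theta>"
proof -
  obtain \<theta> where \<theta>: "0 < \<theta>" "\<theta> < 2 * D" "dist_lattice n (\<lambda>j. \<theta> * z j) < \<gamma> * \<theta>"
    "dist_lattice n (\<lambda>j. \<theta> * z j) < \<alpha>" "LCD n \<gamma> \<alpha> z \<le> ereal \<theta>"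
    using approximate_denominator_of_LCD_less[OF unit LCD(2)] .
  have "ereal D \<le> ereal \<theta>" using LCD(1) \<theta>(5) by (rule order_trans)
  then have "\<alpha> * D \<le> \<alpha> * \<theta>" using pos by (intro mult_left_mono) auto
  then have "\<alpha> \<le> \<alpha> / D * \<theta>" using pos by (simp add: field_simps)
  then show thesis using \<theta> by (intro that[of \<theta>]) (auto simp: min_def)
qed

section \<open>Gaussian averages and characteristic functions\<close>

lemma integral_char_commute:
  assumes "real_distribution M" "real_distribution N"
  shows "(\<integral>x. char N x \<partial>M) = (\<integral>y. char M y \<partial>N)"
proof -
  interpret M: real_distribution M by fact
  interpret N: real_distribution N by fact
  interpret MN: pair_prob_space M N ..
  have "integrable (M \<Otimes>\<^sub>M N) (\<lambda>(x, y). iexp (x * y))"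
    by (intro MN.P.integrable_const_bound[where B = 1]) (auto simp: case_prod_beta)
  then have "(\<integral>y. (\<integral>x. iexp (x * y) \<partial>M) \<partial>N) = (\<integral>x. (\<integral>y. iexp (x * y) \<partial>N) \<partial>M)"
    by (rule MN.Fubini_integral)
  then show ?thesis by (simp add: char_def mult.commute)
qed

context real_distribution
begin

lemma integral_exp_half_square_le_char:
  "(\<integral>s. exp (- s\<^sup>2 / 2) \<partial>M) \<le> (\<integral>u. cmod (char M u) \<partial>std_normal_distribution)"
proof -
  have "complex_of_real (\<integral>s. exp (- s\<^sup>2 / 2) \<partial>M) = (\<integral>s. char std_normal_distribution s \<partial>M)"
    by (simp add: char_std_normal_distribution integral_complex_of_real)
  also have "\<dots> = (\<integral>u. char M u \<partial>std_normal_distribution)"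
    by (rule integral_char_commute[OF real_distribution_axioms real_dist_normal_dist])
  finally have "\<bar>\<integral>s. exp (- s\<^sup>2 / 2) \<partial>M\<bar> = cmod (\<integral>u. char M u \<partial>std_normal_distribution)"
    by (metis norm_of_real)
  also have "\<dots> \<le> (\<integral>u. cmod (char M u) \<partial>std_normal_distribution)"
    by (rule integral_norm_bound)
  finally show ?thesis by linarith
qed

lemma char_distr_divide: "char (distr M borel (\<lambda>s. s / t)) u = char M (u / t)"
  by (simp add: char_def integral_distr)

lemma nn_integral_exp_square_le_char:
  "(\<integral>\<^sup>+s. ennreal (exp (- (s / t)\<^sup>2 / 2)) \<partial>M) \<le> (\<integral>\<^sup>+u. ennreal (cmod (char M (u / t))) \<partial>std_normal_distribution)"
proof -
  interpret scaled: real_distribution "distr M borel (\<lambda>s. s / t)" by simp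
  interpret std: real_distribution std_normal_distribution by (rule real_dist_normal_dist)
  have [measurable]: "(\<lambda>u. char M (u / t)) \<in> borel_measurable borel"
    by (rule measurable_compose[OF _ char_measurable]) measurable
  have exp_int: "integrable M (\<lambda>s. exp (- (s / t)\<^sup>2 / 2))"
    by (intro integrable_const_bound[where B = 1]) auto
  have char_int: "integrable std_normal_distribution (\<lambda>u. cmod (char M (u / t)))"
    by (intro std.integrable_const_bound[where B = 1]) (auto intro: cmod_char_le_1)
  have "(\<integral>\<^sup>+s. ennreal (exp (- (s / t)\<^sup>2 / 2)) \<partial>M) = ennreal (\<integral>s. exp (- (s / t)\<^sup>2 / 2) \<partial>M)"
    using exp_int by (intro nn_integral_eq_integral) auto
  also have "\<dots> \<le> ennreal (\<integral>u. cmod (char M (u / t)) \<partial>std_normal_distribution)"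
    using scaled.integral_exp_half_square_le_char
    by (intro ennreal_leI) (simp add: char_distr_divide integral_distr)
  also have "\<dots> = (\<integral>\<^sup>+u. ennreal (cmod (char M (u / t))) \<partial>std_normal_distribution)"
    using char_int by (intro nn_integral_eq_integral[symmetric]) auto
  finally show ?thesis .
qed

lemma nn_integral_exp_square_le_variance_proxy:
  assumes proxy: "variance_proxy M V" and l: "0 \<le> l" "2 * (V * l) < 1"
  shows "(\<integral>\<^sup>+s. ennreal (exp (l * s\<^sup>2)) \<partial>M) \<le> ennreal (1 / sqrt (1 - 2 * (V * l)))"
proof -
  interpret std: real_distribution std_normal_distribution by (rule real_dist_normal_dist)
  interpret pair: pair_prob_space M std_normal_distribution ..
  let ?c = "sqrt (2 * l)"
  have c: "?c\<^sup>2 = 2 * l" using l by simp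
  have "(\<integral>\<^sup>+s. ennreal (exp (l * s\<^sup>2)) \<partial>M)
      = (\<integral>\<^sup>+s. (\<integral>\<^sup>+u. ennreal (exp (?c * s * u)) \<partial>std_normal_distribution) \<partial>M)"
    unfolding nn_integral_std_normal_exp_linear by (simp add: power_mult_distrib c)
  also have "\<dots> = (\<integral>\<^sup>+u. (\<integral>\<^sup>+s. ennreal (exp (?c * s * u)) \<partial>M) \<partial>std_normal_distribution)"
    by (rule pair.Fubini'[symmetric]) measurable
  also have "\<dots> \<le> (\<integral>\<^sup>+u. ennreal (exp (V * l * u\<^sup>2)) \<partial>std_normal_distribution)"
  proof (rule nn_integral_mono)
    fix u :: real
    have square: "V * (?c * u)\<^sup>2 / 2 = V * l * u\<^sup>2" unfolding power_mult_distrib c by simp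
    show "(\<integral>\<^sup>+s. ennreal (exp (?c * s * u)) \<partial>M) \<le> ennreal (exp (V * l * u\<^sup>2))"
      using variance_proxyD(2)[OF proxy, of "?c * u"] unfolding square by (simp add: mult_ac)
  qed
  also have "\<dots> = ennreal (1 / sqrt (1 - 2 * (V * l)))"
    using l(2) by (rule nn_integral_std_normal_exp_square)
  finally show ?thesis .
qed

lemma fourth_moment_le_variance_proxy:
  assumes proxy: "variance_proxy M V"
  shows "integrable M (\<lambda>s. s ^ 4)" "(\<integral>s. s ^ 4 \<partial>M) \<le> 512 * exp (V / 2)"
proof -
  have "(\<integral>\<^sup>+s. ennreal (s ^ 4) \<partial>M) \<le> (\<integral>\<^sup>+s. 256 * (ennreal (exp (1 * s)) + ennreal (exp (- 1 * s))) \<partial>M)"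
  proof (rule nn_integral_mono)
    fix s :: real
    have "ennreal (s ^ 4) \<le> ennreal (256 * (exp s + exp (- s)))"
      by (intro ennreal_leI power4_le_exp_sum)
    then show "ennreal (s ^ 4) \<le> 256 * (ennreal (exp (1 * s)) + ennreal (exp (- 1 * s)))"
      by (simp add: ennreal_mult)
  qed
  also have "\<dots> = 256 * ((\<integral>\<^sup>+s. ennreal (exp (1 * s)) \<partial>M) + (\<integral>\<^sup>+s. ennreal (exp (- 1 * s)) \<partial>M))"
    by (simp add: nn_integral_cmult nn_integral_add)
  also have "\<dots> \<le> 256 * (ennreal (exp (V / 2)) + ennreal (exp (V / 2)))"
    using variance_proxyD(2)[OF proxy, of 1] variance_proxyD(2)[OF proxy, of "- 1"]
    by (intro mult_left_mono add_mono) auto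
  also have "\<dots> = ennreal (512 * exp (V / 2))"
    by (simp flip: ennreal_plus ennreal_mult ennreal_numeral)
  finally have le: "(\<integral>\<^sup>+s. ennreal (s ^ 4) \<partial>M) \<le> ennreal (512 * exp (V / 2))" .
  then show int: "integrable M (\<lambda>s. s ^ 4)"
    by (intro integrableI_bounded) (auto simp: le_less_trans[OF _ ennreal_less_top] power_abs)
  show "(\<integral>s. s ^ 4 \<partial>M) \<le> 512 * exp (V / 2)"
    using le nn_integral_eq_integral[OF int] by (simp add: ennreal_le_iff)
qed

lemma nn_integral_exp_minus_square_le_fourth_moment:
  assumes second: "integrable M (\<lambda>s. s\<^sup>2)" "(\<integral>s. s\<^sup>2 \<partial>M) = 1"
    and fourth: "integrable M (\<lambda>s. s ^ 4)" "(\<integral>s. s ^ 4 \<partial>M) \<le> Q" and Q: "0 < Q"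
  shows "(\<integral>\<^sup>+s. ennreal (exp (- (1 / Q) * s\<^sup>2)) \<partial>M) \<le> ennreal (1 - 1 / (2 * Q))"
proof -
  define g where "g s = 1 - 1 / Q * s\<^sup>2 + 1 / (2 * Q\<^sup>2) * s ^ 4" for s :: real
  have quadratic: "exp (- (1 / Q) * s\<^sup>2) \<le> g s" for s
    using exp_minus_le_quadratic[of "1 / Q * s\<^sup>2"] Q
    by (simp add: g_def power_mult_distrib power_divide flip: power_mult)
  have g_int: "integrable M g" unfolding g_def using second fourth by auto
  have "(\<integral>\<^sup>+s. ennreal (exp (- (1 / Q) * s\<^sup>2)) \<partial>M) \<le> (\<integral>\<^sup>+s. ennreal (g s) \<partial>M)"
    by (intro nn_integral_mono ennreal_leI quadratic)
  also have "\<dots> = ennreal (\<integral>s. g s \<partial>M)"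
    using g_int by (intro nn_integral_eq_integral AE_I2 order_trans[OF exp_ge_zero quadratic])
  also have "(\<integral>s. g s \<partial>M) = 1 - 1 / Q + 1 / (2 * Q\<^sup>2) * (\<integral>s. s ^ 4 \<partial>M)"
    unfolding g_def using second fourth prob_space by simp
  also have "\<dots> \<le> 1 - 1 / Q + 1 / (2 * Q\<^sup>2) * Q"
    using fourth(2) by (intro add_left_mono mult_left_mono) auto
  also have "\<dots> = 1 - 1 / (2 * Q)" using Q by (simp add: field_simps power2_eq_square)
  finally show ?thesis by (simp add: ennreal_leI)
qed

end

section \<open>Symmetrization\<close>

definition symmetrization :: "real measure \<Rightarrow> real measure" where
  "symmetrization M = distr (M \<Otimes>\<^sub>M M) borel (\<lambda>z. fst z - snd z)"

definition annulus :: "real \<Rightarrow> real \<Rightarrow> real set" where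
  "annulus a b = {d. a \<le> \<bar>d\<bar> \<and> \<bar>d\<bar> \<le> b}"

lemma annulus_borel [measurable]: "annulus a b \<in> sets borel"
  unfolding annulus_def by measurable

lemma (in prob_space) exp_minus_expectation_le_conditional:
  fixes h :: "'a \<Rightarrow> real"
  assumes h: "integrable M h" "\<And>x. 0 \<le> h x" and W: "W \<in> events" "0 < prob W"
  shows "exp (- expectation h) \<le> (\<integral>x. exp (- (prob W * h x)) \<partial>uniform_measure M W)"
proof -
  have uniform: "uniform_measure M W = density M (\<lambda>x. ennreal (indicator W x / prob W))"
    unfolding uniform_measure_def using W
    by (intro density_cong) (auto simp: emeasure_eq_measure divide_ennreal simp flip: ennreal_indicator)
  interpret Q: prob_space "uniform_measure M W"
    using W by (intro prob_space_uniform_measure) (auto simp: emeasure_eq_measure)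
  have hW: "integrable M (\<lambda>x. indicator W x * h x)"
    using integrable_mult_indicator[OF W(1) h(1)] by simp
  have Q_int: "integrable (uniform_measure M W) (\<lambda>x. - (prob W * h x))"
    unfolding uniform using W hW borel_measurable_integrable[OF h(1)]
    by (subst integrable_density) (auto simp: field_simps)
  have "(\<integral>x. indicator W x * h x \<partial>M) \<le> expectation h"
    using hW h by (intro integral_mono) (auto simp: indicator_def)
  moreover have "(\<integral>x. - (prob W * h x) \<partial>uniform_measure M W) = - (\<integral>x. indicator W x * h x \<partial>M)"
    unfolding uniform using W borel_measurable_integrable[OF h(1)]
    by (subst integral_density) auto
  ultimately have "exp (- expectation h) \<le> exp (\<integral>x. - (prob W * h x) \<partial>uniform_measure M W)"
    by simp
  also have "\<dots> \<le> (\<integral>x. exp (- (prob W * h x)) \<partial>uniform_measure M W)"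
  proof (rule Q.jensens_inequality[OF Q_int, where I = UNIV])
    show "integrable (uniform_measure M W) (\<lambda>x. exp (- (prob W * h x)))"
      using h borel_measurable_integrable[OF h(1)]
      by (intro Q.integrable_const_bound[where B = 1] AE_I2) auto
  qed (auto intro: exp_convex)
  finally show ?thesis .
qed

context real_distribution
begin

lemma real_distribution_symmetrization: "real_distribution (symmetrization M)"
proof -
  interpret pair: pair_prob_space M M ..
  show ?thesis unfolding symmetrization_def by (rule pair.P.real_distribution_distr) measurable
qed

lemma char_uminus: "char M (- t) = cnj (char M t)"
proof -
  have "iexp (- t * x) = cnj (iexp (t * x))" for x by (simp add: exp_cnj)
  then show ?thesis by (simp only: char_def Bochner_Integration.integral_cnj)
qed

lemma char_symmetrization: "char (symmetrization M) t = complex_of_real ((cmod (char M t))\<^sup>2)"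
proof -
  interpret pair: pair_prob_space M M ..
  have int: "integrable (M \<Otimes>\<^sub>M M) (\<lambda>z. iexp (t * (fst z - snd z)))"
    by (intro pair.P.integrable_const_bound[where B = 1]) auto
  have "char (symmetrization M) t = (\<integral>z. iexp (t * (fst z - snd z)) \<partial>(M \<Otimes>\<^sub>M M))"
    unfolding symmetrization_def char_def by (subst integral_distr) auto
  also have "\<dots> = (\<integral>x. \<integral>y. iexp (t * x) * iexp (- t * y) \<partial>M \<partial>M)"
    by (subst pair.integral_fst'[OF int, symmetric]) (simp add: algebra_simps flip: exp_add)
  also have "\<dots> = char M t * char M (- t)" by (simp add: char_def)
  also have "\<dots> = complex_of_real ((cmod (char M t))\<^sup>2)"
    unfolding char_uminus by (rule complex_norm_square[symmetric])
  finally show ?thesis .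
qed

lemma cmod_char_le_exp_symmetrization:
  "cmod (char M t) \<le> exp (- (\<integral>d. 1 - cos (t * d) \<partial>symmetrization M) / 2)"
proof -
  interpret sym: real_distribution "symmetrization M" by (rule real_distribution_symmetrization)
  have iexp_int: "integrable (symmetrization M) (\<lambda>d. iexp (t * d))"
    by (intro sym.integrable_iexp) auto
  have cos_int: "integrable (symmetrization M) (\<lambda>d. cos (t * d))"
    by (intro sym.integrable_const_bound[where B = 1]) auto
  have "(\<integral>d. cos (t * d) \<partial>symmetrization M) = Re (char (symmetrization M) t)"
    unfolding char_def integral_Re[OF iexp_int, symmetric] by (simp add: Re_exp)
  then have defect: "(\<integral>d. 1 - cos (t * d) \<partial>symmetrization M) = 1 - (cmod (char M t))\<^sup>2"
    using cos_int sym.prob_space by (simp add: char_symmetrization)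
  show ?thesis
    unfolding defect
  proof (rule power2_le_imp_le)
    have "(cmod (char M t))\<^sup>2 \<le> exp ((cmod (char M t))\<^sup>2 - 1)"
      using exp_ge_add_one_self[of "(cmod (char M t))\<^sup>2 - 1"] by simp
    also have "\<dots> = (exp (- (1 - (cmod (char M t))\<^sup>2) / 2))\<^sup>2"
      by (simp add: power2_eq_square flip: exp_add)
    finally show "(cmod (char M t))\<^sup>2 \<le> (exp (- (1 - (cmod (char M t))\<^sup>2) / 2))\<^sup>2" .
  qed simp
qed

lemma symmetrization_annulus_pos:
  assumes nonconst: "\<And>c. \<not> (AE x in M. x = c)"
  obtains a b where "0 < a" "a \<le> b" "0 < measure (symmetrization M) (annulus a b)"
proof (rule ccontr)
  assume "\<not> thesis"
  interpret sym: real_distribution "symmetrization M" by (rule real_distribution_symmetrization)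
  interpret pair: pair_prob_space M M ..
  let ?W = "\<lambda>k::nat. annulus (1 / (real k + 1)) (real k + 1)"
  have "?W k \<in> null_sets (symmetrization M)" for k
  proof -
    have "1 / (real k + 1) \<le> real k + 1" by (simp add: field_simps)
    then have "measure (symmetrization M) (?W k) = 0"
      using that[of "1 / (real k + 1)" "real k + 1"] \<open>\<not> thesis\<close> by (auto simp: zero_less_measure_iff)
    then show ?thesis by (simp add: null_sets_def sym.emeasure_eq_measure)
  qed
  then have "(\<Union>k. ?W k) \<in> null_sets (symmetrization M)" by (rule null_sets_UN)
  moreover have "d \<in> (\<Union>k. ?W k)" if "d \<noteq> 0" for d
  proof -
    obtain k :: nat where "max \<bar>d\<bar> (1 / \<bar>d\<bar>) \<le> real k" using real_arch_simple by blast
    then have k: "\<bar>d\<bar> \<le> real k + 1" "1 / \<bar>d\<bar> \<le> real k + 1" by auto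
    then have "1 / (real k + 1) \<le> \<bar>d\<bar>" using that by (simp add: field_simps)
    then show ?thesis using k by (auto simp: annulus_def)
  qed
  ultimately have "AE d in symmetrization M. d = 0"
    by (intro AE_I'[of "\<Union>k. ?W k"]) auto
  then have "AE z in M \<Otimes>\<^sub>M M. fst z - snd z = 0"
    unfolding symmetrization_def by (rule AE_distrD[rotated]) measurable
  then have "AE x in M. AE y in M. x - y = 0"
    using pair.AE_pair by fastforce
  then obtain c where "AE y in M. c - y = 0"
    using eventually_happens'[OF ae_filter_bot] by blast
  then have "AE y in M. y = c" by eventually_elim simp
  with nonconst show False by blast
qed

lemma prod_cmod_char_le_exp_dist_lattice:
  "(\<Prod>j<n. cmod (char M (v * x j)))
    \<le> exp (- (\<integral>d. (dist_lattice n (\<lambda>j. v * d / (2 * pi) * x j))\<^sup>2 / 2 \<partial>symmetrization M))"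
proof -
  interpret sym: real_distribution "symmetrization M" by (rule real_distribution_symmetrization)
  let ?S = "symmetrization M"
  define h where "h d = (dist_lattice n (\<lambda>j. v * d / (2 * pi) * x j))\<^sup>2" for d
  define C where "C d = (\<Sum>j<n. 1 - cos (v * x j * d))" for d
  have h_le: "h d \<le> C d" for d
    using dist_lattice_power2_le_cos[of n "\<lambda>j. v * d / (2 * pi) * x j"]
    by (simp add: h_def C_def mult_ac)
  have cos_int: "integrable ?S (\<lambda>d. 1 - cos (v * x j * d))" for j
    by (intro Bochner_Integration.integrable_diff sym.integrable_const_bound[where B = 1] AE_I2) auto
  have C_int: "integrable ?S C" unfolding C_def using cos_int by auto
  have "h \<in> borel_measurable borel"
    unfolding h_def by (intro borel_measurable_power borel_measurable_dist_lattice) measurable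
  moreover have "norm (h d) \<le> norm (C d)" for d
  proof -
    have "0 \<le> h d" by (simp add: h_def)
    then show ?thesis using h_le[of d] by simp
  qed
  ultimately have h_int: "integrable ?S h"
    by (intro Bochner_Integration.integrable_bound[OF C_int]) auto
  have "(\<Prod>j<n. cmod (char M (v * x j))) \<le> (\<Prod>j<n. exp (- (\<integral>d. 1 - cos (v * x j * d) \<partial>?S) / 2))"
    by (intro prod_mono conjI cmod_char_le_exp_symmetrization) auto
  also have "\<dots> = exp (- (\<integral>d. C d \<partial>?S) / 2)"
    unfolding C_def using cos_int
    by (subst Bochner_Integration.integral_sum) (auto simp: exp_sum sum_divide_distrib simp flip: sum_negf)
  also have "\<dots> \<le> exp (- (\<integral>d. h d / 2 \<partial>?S))"
    using integral_mono[OF h_int C_int h_le] by simp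
  finally show ?thesis by (simp add: h_def)
qed

end

section \<open>Linear forms in independent variables\<close>

lemma indep_vars_PiM_coordinates:
  assumes "\<And>i. i \<in> I \<Longrightarrow> prob_space (M i)"
  shows "prob_space.indep_vars (PiM I M) M (\<lambda>i \<omega>. \<omega> i) I"
proof -
  interpret P: prob_space "PiM I M" using assms by (rule prob_space_PiM)
  show ?thesis
  proof (cases "I = {}")
    case True
    then show ?thesis unfolding P.indep_vars_def P.indep_sets_def by auto
  next
    case False
    have "distr (PiM I M) (PiM I M) (\<lambda>\<omega>. \<lambda>i\<in>I. \<omega> i) = PiM I M"
      by (subst distr_cong[of _ _ _ _ _ "\<lambda>\<omega>. \<omega>"])
        (auto simp: space_PiM PiE_restrict distr_id2)
    also have "\<dots> = PiM I (\<lambda>i. distr (PiM I M) (M i) (\<lambda>\<omega>. \<omega> i))"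
      using assms by (intro PiM_cong) (auto simp: distr_PiM_component)
    finally show ?thesis
      using False by (subst P.indep_vars_iff_distr_eq_PiM') auto
  qed
qed

context real_distribution
begin

lemma prob_space_PiM_const: "prob_space (PiM I (\<lambda>_. M))"
  by (intro prob_space_PiM prob_space_axioms)

lemma indep_vars_scaled_coordinates:
  "prob_space.indep_vars (PiM I (\<lambda>_. M)) (\<lambda>_. borel) (\<lambda>i \<omega>. a i * \<omega> i) I"
  by (rule prob_space.indep_vars_compose2[OF prob_space_PiM_const indep_vars_PiM_coordinates])
    (auto intro: prob_space_axioms)

lemma distr_coordinate: "i \<in> I \<Longrightarrow> distr (PiM I (\<lambda>_. M)) M (\<lambda>\<omega>. \<omega> i) = M"
  by (intro distr_PiM_component prob_space_axioms)

lemma nn_integral_coordinate: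
  assumes "i \<in> I" "f \<in> borel_measurable M"
  shows "(\<integral>\<^sup>+\<omega>. f (\<omega> i) \<partial>PiM I (\<lambda>_. M)) = (\<integral>\<^sup>+x. f x \<partial>M)"
  using assms by (subst (2) distr_coordinate[OF assms(1), symmetric]) (simp add: nn_integral_distr)

lemma integral_coordinate:
  fixes f :: "real \<Rightarrow> 'b::{banach, second_countable_topology}"
  assumes "i \<in> I" "f \<in> borel_measurable M"
  shows "(\<integral>\<omega>. f (\<omega> i) \<partial>PiM I (\<lambda>_. M)) = (\<integral>x. f x \<partial>M)"
  using assms by (subst (2) distr_coordinate[OF assms(1), symmetric]) (simp add: integral_distr)

lemma integrable_coordinate:
  fixes f :: "real \<Rightarrow> 'b::{banach, second_countable_topology}"
  assumes "i \<in> I" "integrable M f"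
  shows "integrable (PiM I (\<lambda>_. M)) (\<lambda>\<omega>. f (\<omega> i))"
proof (rule integrable_distr[where T = "\<lambda>\<omega>. \<omega> i" and M' = M])
  show "(\<lambda>\<omega>. \<omega> i) \<in> PiM I (\<lambda>_. M) \<rightarrow>\<^sub>M M" using assms(1) by measurable
  show "integrable (distr (PiM I (\<lambda>_. M)) M (\<lambda>\<omega>. \<omega> i)) f" using assms by (simp add: distr_coordinate)
qed

definition form_law :: "nat \<Rightarrow> (nat \<Rightarrow> real) \<Rightarrow> real measure" where
  "form_law n x = distr (PiM {..<n} (\<lambda>_. M)) borel (\<lambda>v. \<Sum>j<n. x j * v j)"

lemma linear_form_measurable [measurable]:
  "(\<lambda>v. \<Sum>j<n. x j * v j) \<in> borel_measurable (PiM {..<n} (\<lambda>_. M))"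
  by (intro borel_measurable_sum) measurable

lemma real_distribution_form_law: "real_distribution (form_law n x)"
  unfolding form_law_def
  by (intro prob_space.real_distribution_distr prob_space_PiM_const linear_form_measurable)

lemma nn_integral_form_law:
  "f \<in> borel_measurable borel \<Longrightarrow>
    (\<integral>\<^sup>+s. f s \<partial>form_law n x) = (\<integral>\<^sup>+v. f (\<Sum>j<n. x j * v j) \<partial>PiM {..<n} (\<lambda>_. M))"
  unfolding form_law_def by (intro nn_integral_distr) auto

lemma char_form_law: "char (form_law n x) u = (\<Prod>j<n. char M (u * x j))"
proof -
  interpret P: prob_space "PiM {..<n} (\<lambda>_. M)" by (rule prob_space_PiM_const)
  have "char (form_law n x) u = (\<Prod>j<n. char (distr (PiM {..<n} (\<lambda>_. M)) borel (\<lambda>v. x j * v j)) u)"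
    unfolding form_law_def by (rule P.char_distr_sum[OF indep_vars_scaled_coordinates])
  also have "\<dots> = (\<Prod>j<n. char M (u * x j))"
  proof (rule prod.cong)
    fix j assume j: "j \<in> {..<n}"
    have "char (distr (PiM {..<n} (\<lambda>_. M)) borel (\<lambda>v. x j * v j)) u
        = (\<integral>v. iexp (u * x j * v j) \<partial>PiM {..<n} (\<lambda>_. M))"
      using j by (simp add: char_def integral_distr mult.assoc)
    also have "\<dots> = char M (u * x j)"
      unfolding char_def using j by (intro integral_coordinate) auto
    finally show "char (distr (PiM {..<n} (\<lambda>_. M)) borel (\<lambda>v. x j * v j)) u = char M (u * x j)" .
  qed simp
  finally show ?thesis .
qed

lemma variance_proxy_form_law:
  assumes proxy: "variance_proxy M V"
  shows "variance_proxy (form_law n x) (V * (vnorm n x)\<^sup>2)"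
proof -
  interpret P: prob_space "PiM {..<n} (\<lambda>_. M)" by (rule prob_space_PiM_const)
  have "(\<integral>\<^sup>+t. ennreal (exp (s * t)) \<partial>form_law n x) \<le> ennreal (exp (V * (vnorm n x)\<^sup>2 * s\<^sup>2 / 2))" for s
  proof -
    have "(\<integral>\<^sup>+t. ennreal (exp (s * t)) \<partial>form_law n x)
        = (\<integral>\<^sup>+v. (\<Prod>j<n. ennreal (exp (s * x j * v j))) \<partial>PiM {..<n} (\<lambda>_. M))"
      by (simp add: nn_integral_form_law sum_distrib_left exp_sum prod_ennreal mult.assoc)
    also have "\<dots> = (\<Prod>j<n. \<integral>\<^sup>+v. ennreal (exp (s * x j * v j)) \<partial>PiM {..<n} (\<lambda>_. M))"
      by (rule P.indep_vars_nn_integral[OF _ P.indep_vars_compose2[OF indep_vars_scaled_coordinates]]) auto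
    also have "\<dots> = (\<Prod>j<n. \<integral>\<^sup>+y. ennreal (exp (s * x j * y)) \<partial>M)"
      by (intro prod.cong refl nn_integral_coordinate) auto
    also have "\<dots> \<le> (\<Prod>j<n. ennreal (exp (V * (s * x j)\<^sup>2 / 2)))"
      by (intro prod_mono_ennreal variance_proxyD(2)[OF proxy])
    also have "\<dots> = ennreal (exp (\<Sum>j<n. V * (s * x j)\<^sup>2 / 2))"
      by (simp add: prod_ennreal exp_sum)
    also have "(\<Sum>j<n. V * (s * x j)\<^sup>2 / 2) = V * (vnorm n x)\<^sup>2 * s\<^sup>2 / 2"
      unfolding vnorm_power2 sum_distrib_left sum_distrib_right sum_divide_distrib
      by (simp add: power_mult_distrib mult_ac)
    finally show ?thesis .
  qed
  then show ?thesis using variance_proxyD(1)[OF proxy] by (simp add: variance_proxy_def)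
qed

end

section \<open>Small ball probabilities\<close>

lemma nn_integral_std_normal_exp_dist_lattice_le:
  assumes x: "vnorm n x = 1" "ereal D \<le> LCD n \<gamma> \<alpha> x" and pos: "0 < \<gamma>" "0 < \<alpha>" "0 < \<kappa>"
    and c: "c \<noteq> 0" and l: "0 < l" "l * \<bar>c\<bar> < D"
  shows "(\<integral>\<^sup>+u. ennreal (exp (- \<kappa> * (dist_lattice n (\<lambda>j. u * c * x j))\<^sup>2)) \<partial>std_normal_distribution)
    \<le> ennreal (2 * (1 + 1 / l) * (sqrt (4 * pi / \<kappa>) / (\<gamma> * \<bar>c\<bar>) + l * exp (- \<kappa> * \<alpha>\<^sup>2 / 4)))"
proof -
  define g where "g u = dist_lattice n (\<lambda>j. u * c * x j)" for u
  have "continuous_on UNIV g"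
    unfolding g_def by (intro continuous_on_compose2[OF continuous_on_dist_lattice[of UNIV n x]]
        continuous_intros) auto
  moreover have "g (v - w) \<le> g v + g w" for v w
    unfolding g_def using dist_lattice_diff[of n "\<lambda>j. v * c * x j" "\<lambda>j. w * c * x j"]
    by (simp add: left_diff_distrib)
  moreover have "min (\<gamma> * \<bar>c\<bar> * \<bar>v\<bar>) \<alpha> \<le> g v" if "\<bar>v\<bar> < D / \<bar>c\<bar>" for v
    using min_le_dist_lattice[OF x, of "v * c"] that c by (simp add: g_def abs_mult field_simps mult_ac)
  moreover have "l < D / \<bar>c\<bar>" using c l by (simp add: field_simps)
  ultimately have interval: "(\<integral>\<^sup>+u. ennreal (exp (- \<kappa> * (g u)\<^sup>2)) * indicator {s..s + l} u \<partial>lborel)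
      \<le> ennreal (sqrt (4 * pi / \<kappa>) / (\<gamma> * \<bar>c\<bar>) + l * exp (- \<kappa> * \<alpha>\<^sup>2 / 4))" for s
    using pos c l by (intro nn_integral_exp_subadditive_interval[of g "D / \<bar>c\<bar>"]) auto
  have [measurable]: "g \<in> borel_measurable borel"
    unfolding g_def by (intro borel_measurable_dist_lattice) measurable
  have "(\<integral>\<^sup>+u. ennreal (exp (- \<kappa> * (g u)\<^sup>2)) \<partial>std_normal_distribution)
      \<le> ennreal (2 * (1 + 1 / l)) * ennreal (sqrt (4 * pi / \<kappa>) / (\<gamma> * \<bar>c\<bar>) + l * exp (- \<kappa> * \<alpha>\<^sup>2 / 4))"
    by (rule nn_integral_std_normal_le_intervals[OF _ l(1) interval]) measurable
  then show ?thesis using l(1) pos by (simp add: g_def ennreal_mult)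
qed

lemma nn_integral_std_normal_exp_dist_lattice_annulus_le:
  assumes x: "vnorm n x = 1" "ereal D \<le> LCD n \<gamma> \<alpha> x" and pos: "0 < \<gamma>" "0 < \<alpha>" "0 < \<kappa>"
    and D: "0 < D" "1 / D \<le> t" and ab: "0 < a" "a \<le> b" and d: "d \<in> annulus a b"
  shows "(\<integral>\<^sup>+u. ennreal (exp (- \<kappa> * (dist_lattice n (\<lambda>j. u * (d / (2 * pi * t)) * x j))\<^sup>2)) \<partial>std_normal_distribution)
    \<le> ennreal (2 * (1 + b) * (sqrt (4 * pi / \<kappa>) * (2 * pi / a) + 1 / b) * (t / \<gamma> + exp (- \<kappa> * \<alpha>\<^sup>2 / 4)))"
proof -
  let ?e = "exp (- \<kappa> * \<alpha>\<^sup>2 / 4)"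
  define c where "c = d / (2 * pi * t)"
  define A where "A = sqrt (4 * pi / \<kappa>) * (2 * pi / a)"
  have t: "0 < t" using D(1) by (intro less_le_trans[OF _ D(2)]) simp
  have b: "0 < 1 / b" using ab by simp
  have A: "0 \<le> A" using ab pos by (simp add: A_def)
  have c: "c \<noteq> 0" "\<bar>c\<bar> = \<bar>d\<bar> / (2 * pi * t)"
    using d ab t by (auto simp: c_def annulus_def abs_mult)
  have "1 / b * \<bar>c\<bar> \<le> 1 / (2 * pi * t)" using d ab t by (simp add: c annulus_def field_simps)
  also have "\<dots> < 1 / t" using t pi_gt3 by (intro divide_strict_left_mono) auto
  also have "\<dots> \<le> D" using D t by (simp add: field_simps)
  finally have short: "1 / b * \<bar>c\<bar> < D" .
  have "sqrt (4 * pi / \<kappa>) / (\<gamma> * \<bar>c\<bar>) = sqrt (4 * pi / \<kappa>) * (2 * pi / \<bar>d\<bar>) * (t / \<gamma>)"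
    by (simp add: c mult_ac)
  also have "\<dots> \<le> A * (t / \<gamma>)"
    unfolding A_def using d ab t pos
    by (intro mult_right_mono mult_left_mono divide_left_mono) (auto simp: annulus_def)
  finally have "sqrt (4 * pi / \<kappa>) / (\<gamma> * \<bar>c\<bar>) + 1 / b * ?e \<le> A * (t / \<gamma>) + 1 / b * ?e" by simp
  also have "\<dots> \<le> (A + 1 / b) * (t / \<gamma>) + (A + 1 / b) * ?e"
    using A b t pos by (intro add_mono mult_right_mono) auto
  finally have "2 * (1 + 1 / (1 / b)) * (sqrt (4 * pi / \<kappa>) / (\<gamma> * \<bar>c\<bar>) + 1 / b * ?e)
      \<le> 2 * (1 + b) * (A + 1 / b) * (t / \<gamma> + ?e)"
    using ab by (simp add: distrib_left[of "A + 1 / b"] mult.assoc)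
  with nn_integral_std_normal_exp_dist_lattice_le[OF x pos c(1) b short] show ?thesis
    unfolding c_def[symmetric] A_def[symmetric] by (auto intro: order_trans ennreal_leI)
qed

context real_distribution
begin

lemma prod_cmod_char_le_conditional:
  assumes W: "W \<in> sets borel" "0 < measure (symmetrization M) W" (is "0 < ?p")
  shows "ennreal (\<Prod>j<n. cmod (char M (v * x j)))
    \<le> (\<integral>\<^sup>+d. ennreal (exp (- (?p / 2) * (dist_lattice n (\<lambda>j. v * d / (2 * pi) * x j))\<^sup>2))
        \<partial>uniform_measure (symmetrization M) W)"
proof -
  interpret sym: real_distribution "symmetrization M" by (rule real_distribution_symmetrization)
  interpret Q: prob_space "uniform_measure (symmetrization M) W"
    using W by (intro prob_space_uniform_measure) (auto simp: sym.emeasure_eq_measure)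
  define h where "h d = (dist_lattice n (\<lambda>j. v * d / (2 * pi) * x j))\<^sup>2 / 2" for d
  have [measurable]: "h \<in> borel_measurable borel"
    unfolding h_def by (intro borel_measurable_divide borel_measurable_power borel_measurable_dist_lattice) measurable
  have h: "0 \<le> h d" "h d \<le> real n" for d
  proof -
    have "1 - cos y \<le> 2" for y :: real using cos_ge_minus_one[of y] by linarith
    then have "(dist_lattice n (\<lambda>j. v * d / (2 * pi) * x j))\<^sup>2 \<le> (\<Sum>j<n. 2)"
      by (intro order_trans[OF dist_lattice_power2_le_cos sum_mono])
    then show "0 \<le> h d" "h d \<le> real n" by (auto simp: h_def)
  qed
  have "(\<Prod>j<n. cmod (char M (v * x j))) \<le> exp (- (\<integral>d. h d \<partial>symmetrization M))"
    unfolding h_def by (rule prod_cmod_char_le_exp_dist_lattice)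
  also have "\<dots> \<le> (\<integral>d. exp (- (?p * h d)) \<partial>uniform_measure (symmetrization M) W)"
    using h W by (intro sym.exp_minus_expectation_le_conditional sym.integrable_const_bound[where B = "real n"]) auto
  finally have "ennreal (\<Prod>j<n. cmod (char M (v * x j)))
      \<le> ennreal (\<integral>d. exp (- (?p * h d)) \<partial>uniform_measure (symmetrization M) W)"
    by (rule ennreal_leI)
  also have "\<dots> = (\<integral>\<^sup>+d. ennreal (exp (- (?p * h d))) \<partial>uniform_measure (symmetrization M) W)"
    using h W by (intro nn_integral_eq_integral[symmetric] Q.integrable_const_bound[where B = 1]) auto
  finally show ?thesis by (simp add: h_def mult.commute)
qed

lemma nn_integral_exp_square_form_law_le:
  assumes W: "W \<in> sets borel" "0 < measure (symmetrization M) W"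
    and p: "p = measure (symmetrization M) W"
    and bound: "\<And>d. d \<in> W \<Longrightarrow>
      (\<integral>\<^sup>+u. ennreal (exp (- (p / 2) * (dist_lattice n (\<lambda>j. u * (d / (2 * pi * t)) * x j))\<^sup>2))
        \<partial>std_normal_distribution) \<le> B"
  shows "(\<integral>\<^sup>+s. ennreal (exp (- (s / t)\<^sup>2 / 2)) \<partial>form_law n x) \<le> B"
proof -
  let ?Q = "uniform_measure (symmetrization M) W"
  let ?h = "\<lambda>u d. ennreal (exp (- (p / 2) * (dist_lattice n (\<lambda>j. u * (d / (2 * pi * t)) * x j))\<^sup>2))"
  interpret form: real_distribution "form_law n x" by (rule real_distribution_form_law)
  interpret sym: real_distribution "symmetrization M" by (rule real_distribution_symmetrization)
  interpret Q: prob_space ?Q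
    using W by (intro prob_space_uniform_measure) (auto simp: sym.emeasure_eq_measure)
  interpret std: real_distribution std_normal_distribution by (rule real_dist_normal_dist)
  interpret pair: pair_prob_space std_normal_distribution ?Q ..
  have "(\<integral>\<^sup>+s. ennreal (exp (- (s / t)\<^sup>2 / 2)) \<partial>form_law n x)
      \<le> (\<integral>\<^sup>+u. ennreal (\<Prod>j<n. cmod (char M (u / t * x j))) \<partial>std_normal_distribution)"
    using form.nn_integral_exp_square_le_char[of t] by (simp add: char_form_law prod_norm)
  also have "\<dots> \<le> (\<integral>\<^sup>+u. \<integral>\<^sup>+d. ?h u d \<partial>?Q \<partial>std_normal_distribution)"
  proof (rule nn_integral_mono)
    fix u
    show "ennreal (\<Prod>j<n. cmod (char M (u / t * x j))) \<le> (\<integral>\<^sup>+d. ?h u d \<partial>?Q)"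
      using prod_cmod_char_le_conditional[OF W, where v = "u / t" and n = n and x = x] by (simp add: p mult_ac)
  qed
  also have "\<dots> = (\<integral>\<^sup>+d. \<integral>\<^sup>+u. ?h u d \<partial>std_normal_distribution \<partial>?Q)"
  proof (rule pair.Fubini'[symmetric])
    have "(\<lambda>w. dist_lattice n (\<lambda>j. fst w * (snd w / (2 * pi * t)) * x j))
        \<in> borel_measurable (std_normal_distribution \<Otimes>\<^sub>M ?Q)"
      by (intro borel_measurable_dist_lattice) measurable
    then show "(\<lambda>(u, d). ?h u d) \<in> borel_measurable (std_normal_distribution \<Otimes>\<^sub>M ?Q)"
      unfolding case_prod_beta by measurable
  qed
  also have "\<dots> \<le> (\<integral>\<^sup>+d. B \<partial>?Q)"
    using W bound by (intro nn_integral_mono_AE AE_uniform_measureI) auto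
  also have "\<dots> = B" using Q.emeasure_space_1 by simp
  finally show ?thesis .
qed

theorem small_ball_LCD:
  assumes nonconst: "\<And>c. \<not> (AE x in M. x = c)"
  obtains C \<kappa> where "0 < C" "0 < \<kappa>"
    "\<And>n x D \<gamma> \<alpha> t. \<lbrakk>vnorm n x = 1; ereal D \<le> LCD n \<gamma> \<alpha> x; 0 < \<gamma>; 0 < \<alpha>; 0 < D; 1 / D \<le> t\<rbrakk> \<Longrightarrow>
      (\<integral>\<^sup>+s. ennreal (exp (- (s / t)\<^sup>2 / 2)) \<partial>form_law n x) \<le> ennreal (C * (t / \<gamma> + exp (- \<kappa> * \<alpha>\<^sup>2)))"
proof -
  obtain a b where ab: "0 < a" "a \<le> b" and p: "0 < measure (symmetrization M) (annulus a b)" (is "0 < ?p")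
    using symmetrization_annulus_pos[OF nonconst] .
  define C where "C = 2 * (1 + b) * (sqrt (4 * pi / (?p / 2)) * (2 * pi / a) + 1 / b)"
  have C: "0 < C" unfolding C_def using ab p by (intro mult_pos_pos add_nonneg_pos) auto
  have small_ball: "(\<integral>\<^sup>+s. ennreal (exp (- (s / t)\<^sup>2 / 2)) \<partial>form_law n x)
      \<le> ennreal (C * (t / \<gamma> + exp (- (?p / 8) * \<alpha>\<^sup>2)))"
    if "vnorm n x = 1" "ereal D \<le> LCD n \<gamma> \<alpha> x" "0 < \<gamma>" "0 < \<alpha>" "0 < D" "1 / D \<le> t" for n x D \<gamma> \<alpha> t
  proof (rule nn_integral_exp_square_form_law_le[OF annulus_borel p refl])
    fix d assume "d \<in> annulus a b"
    from nn_integral_std_normal_exp_dist_lattice_annulus_le[OF that(1-4) _ that(5,6) ab this, of "?p / 2"] p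
    show "(\<integral>\<^sup>+u. ennreal (exp (- (?p / 2) * (dist_lattice n (\<lambda>j. u * (d / (2 * pi * t)) * x j))\<^sup>2)) \<partial>std_normal_distribution)
        \<le> ennreal (C * (t / \<gamma> + exp (- (?p / 8) * \<alpha>\<^sup>2)))"
      by (simp add: C_def)
  qed
  show thesis by (rule that[OF C _ small_ball]) (use p in auto)
qed

end

section \<open>Standardized distributions\<close>

locale standardized_distribution = real_distribution +
  assumes mean: "integrable M (\<lambda>x. x)" "(\<integral>x. x \<partial>M) = 0"
    and variance: "integrable M (\<lambda>x. x\<^sup>2)" "(\<integral>x. x\<^sup>2 \<partial>M) = 1"
begin

lemma not_AE_const: "\<not> (AE x in M. x = c)"
proof
  assume const: "AE x in M. x = c"
  have "(\<integral>x. f x \<partial>M) = (\<integral>x. f c \<partial>M)" if "f \<in> borel_measurable borel" for f :: "real \<Rightarrow> real"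
    by (rule integral_cong_AE) (use const that in auto)
  from this[of "\<lambda>x. x"] this[of "\<lambda>x. x\<^sup>2"] have "c = 0" "c\<^sup>2 = 1"
    using mean(2) variance(2) prob_space by simp_all
  then show False by simp
qed

lemma product_of_coordinates:
  assumes ij: "i \<in> I" "j \<in> I"
  shows "integrable (PiM I (\<lambda>_. M)) (\<lambda>\<omega>. \<omega> i * \<omega> j)"
    and "(\<integral>\<omega>. \<omega> i * \<omega> j \<partial>PiM I (\<lambda>_. M)) = of_bool (i = j)"
proof -
  interpret P: prob_space "PiM I (\<lambda>_. M)" by (rule prob_space_PiM_const)
  have "integrable (PiM I (\<lambda>_. M)) (\<lambda>\<omega>. \<omega> i * \<omega> j) \<and> (\<integral>\<omega>. \<omega> i * \<omega> j \<partial>PiM I (\<lambda>_. M)) = of_bool (i = j)"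
  proof (cases "i = j")
    case True
    then show ?thesis
      using integrable_coordinate[OF ij(1) variance(1)] integral_coordinate[OF ij(1), of "\<lambda>x. x\<^sup>2"] variance(2)
      by (simp add: power2_eq_square)
  next
    case False
    have "P.indep_vars (\<lambda>_. borel) (\<lambda>k \<omega>. \<omega> k) {i, j}"
      using P.indep_vars_subset[OF indep_vars_scaled_coordinates[of I "\<lambda>_. 1"], of "{i, j}"] ij by simp
    then have indep: "finite {i, j}" "P.indep_vars (\<lambda>_. borel) (\<lambda>k \<omega>. \<omega> k) {i, j}" by auto
    have "integrable (PiM I (\<lambda>_. M)) (\<lambda>\<omega>. \<omega> k)" if "k \<in> {i, j}" for k
      using that ij mean(1) by (auto intro: integrable_coordinate)
    from P.indep_vars_integrable[OF indep this] P.indep_vars_lebesgue_integral[OF indep this] show ?thesis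
      using False integral_coordinate[OF ij(1), of "\<lambda>x. x"] mean(2) by simp
  qed
  then show "integrable (PiM I (\<lambda>_. M)) (\<lambda>\<omega>. \<omega> i * \<omega> j)"
    "(\<integral>\<omega>. \<omega> i * \<omega> j \<partial>PiM I (\<lambda>_. M)) = of_bool (i = j)" by auto
qed

lemma second_moment_form_law:
  shows "integrable (form_law n x) (\<lambda>s. s\<^sup>2)" "(\<integral>s. s\<^sup>2 \<partial>form_law n x) = (vnorm n x)\<^sup>2"
proof -
  let ?P = "PiM {..<n} (\<lambda>_. M)"
  have expand: "(\<Sum>j<n. x j * v j)\<^sup>2 = (\<Sum>i<n. \<Sum>j<n. x i * x j * (v i * v j))" for v :: "nat \<Rightarrow> real"
    by (simp add: power2_eq_square sum_product algebra_simps)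
  have int: "integrable ?P (\<lambda>v. x i * x j * (v i * v j))" if "i < n" "j < n" for i j
    using product_of_coordinates(1)[of i "{..<n}" j] that by simp
  show "integrable (form_law n x) (\<lambda>s. s\<^sup>2)"
    unfolding form_law_def
    by (subst integrable_distr_eq) (auto simp: expand intro!: Bochner_Integration.integrable_sum int)
  have "(\<integral>s. s\<^sup>2 \<partial>form_law n x) = (\<integral>v. (\<Sum>i<n. \<Sum>j<n. x i * x j * (v i * v j)) \<partial>?P)"
    unfolding form_law_def by (subst integral_distr) (auto simp: expand)
  also have "\<dots> = (\<Sum>i<n. \<integral>v. (\<Sum>j<n. x i * x j * (v i * v j)) \<partial>?P)"
    by (intro Bochner_Integration.integral_sum Bochner_Integration.integrable_sum int) auto
  also have "\<dots> = (\<Sum>i<n. \<Sum>j<n. \<integral>v. x i * x j * (v i * v j) \<partial>?P)"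
    by (intro sum.cong refl Bochner_Integration.integral_sum int) auto
  also have "\<dots> = (\<Sum>i<n. \<Sum>j<n. x i * x j * (\<integral>v. v i * v j \<partial>?P))"
    by simp
  also have "\<dots> = (\<Sum>i<n. \<Sum>j<n. if i = j then x i * x j else 0)"
    using product_of_coordinates(2)[of _ "{..<n}"] by (intro sum.cong refl) auto
  also have "\<dots> = (vnorm n x)\<^sup>2"
    unfolding vnorm_power2 by (simp add: power2_eq_square)
  finally show "(\<integral>s. s\<^sup>2 \<partial>form_law n x) = (vnorm n x)\<^sup>2" .
qed

lemma form_law_laplace_lt_1:
  assumes proxy: "variance_proxy M V" and unit: "vnorm n x = 1"
  shows "(\<integral>\<^sup>+s. ennreal (exp (- (1 / (512 * exp (V / 2))) * s\<^sup>2)) \<partial>form_law n x)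
    \<le> ennreal (1 - 1 / (2 * (512 * exp (V / 2))))"
proof -
  interpret form: real_distribution "form_law n x" by (rule real_distribution_form_law)
  have "variance_proxy (form_law n x) V"
    using variance_proxy_form_law[OF proxy, of n x] unit by simp
  from form.fourth_moment_le_variance_proxy[OF this] show ?thesis
    using second_moment_form_law[of n x] unit
    by (intro form.nn_integral_exp_minus_square_le_fourth_moment) auto
qed

end

section \<open>Matrices\<close>

definition mat_vec :: "nat \<Rightarrow> (nat \<times> nat \<Rightarrow> real) \<Rightarrow> (nat \<Rightarrow> real) \<Rightarrow> nat \<Rightarrow> real" where
  "mat_vec n B x i = (\<Sum>j<n. x j * B (i, j))"

definition bounded_operator :: "nat \<Rightarrow> nat \<Rightarrow> real \<Rightarrow> (nat \<times> nat \<Rightarrow> real) \<Rightarrow> bool" where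
  "bounded_operator m n R B \<longleftrightarrow> (\<forall>x. vnorm m (mat_vec n B x) \<le> R * vnorm n x)"

definition unit_kernel :: "nat \<Rightarrow> nat \<Rightarrow> (nat \<times> nat \<Rightarrow> real) \<Rightarrow> (nat \<Rightarrow> real) set" where
  "unit_kernel m n B = {z. vnorm n z = 1 \<and> (\<forall>i<m. mat_vec n B z i = 0)}"

lemma bounded_operatorD: "bounded_operator m n R B \<Longrightarrow> vnorm m (mat_vec n B x) \<le> R * vnorm n x"
  by (simp add: bounded_operator_def)

lemma mat_vec_diff: "mat_vec n B (\<lambda>j. x j - y j) = (\<lambda>i. mat_vec n B x i - mat_vec n B y i)"
  by (simp add: mat_vec_def left_diff_distrib sum_subtractf fun_eq_iff)

lemma mat_vec_divide: "mat_vec n B (\<lambda>j. x j / c) = (\<lambda>i. mat_vec n B x i / c)"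
  by (simp add: mat_vec_def sum_divide_distrib fun_eq_iff)

lemma bounded_operator_exists:
  obtains R where "0 \<le> R" "bounded_operator m n R B"
proof -
  have "vnorm m (mat_vec n B x) \<le> vnorm m (\<lambda>i. \<Sum>j<n. \<bar>B (i, j)\<bar>) * vnorm n x" for x
  proof -
    have "vnorm m (mat_vec n B x) \<le> vnorm m (\<lambda>i. vnorm n x * (\<Sum>j<n. \<bar>B (i, j)\<bar>))"
    proof (rule vnorm_mono)
      fix i
      have "\<bar>mat_vec n B x i\<bar> \<le> (\<Sum>j<n. \<bar>x j\<bar> * \<bar>B (i, j)\<bar>)"
        unfolding mat_vec_def by (rule order_trans[OF sum_abs]) (simp add: abs_mult)
      also have "\<dots> \<le> (\<Sum>j<n. vnorm n x * \<bar>B (i, j)\<bar>)"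
        by (intro sum_mono mult_right_mono abs_component_le_vnorm) auto
      finally show "\<bar>mat_vec n B x i\<bar> \<le> \<bar>vnorm n x * (\<Sum>j<n. \<bar>B (i, j)\<bar>)\<bar>"
        by (simp add: sum_distrib_left)
    qed
    then show ?thesis unfolding vnorm_scale by (simp add: mult.commute)
  qed
  then show thesis using that[of "vnorm m (\<lambda>i. \<Sum>j<n. \<bar>B (i, j)\<bar>)"] by (simp add: bounded_operator_def)
qed

lemma bounded_operator_improve:
  assumes R: "bounded_operator m n R B" "0 \<le> R"
    and net: "\<And>x. vnorm n x \<le> 1 \<Longrightarrow> \<exists>y. vnorm n (\<lambda>j. x j - y j) \<le> \<epsilon> \<and> vnorm m (mat_vec n B y) \<le> r"
  shows "bounded_operator m n (r + \<epsilon> * R) B"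
  unfolding bounded_operator_def
proof
  fix x
  show "vnorm m (mat_vec n B x) \<le> (r + \<epsilon> * R) * vnorm n x"
  proof (cases "vnorm n x = 0")
    case True
    then show ?thesis using bounded_operatorD[OF R(1), of x] by simp
  next
    case False
    define u where "u j = x j / vnorm n x" for j
    have x: "0 < vnorm n x" using False vnorm_nonneg[of n x] by linarith
    have "vnorm n u = 1" using False by (simp add: u_def[abs_def] vnorm_divide)
    then obtain y where y: "vnorm n (\<lambda>j. u j - y j) \<le> \<epsilon>" "vnorm m (mat_vec n B y) \<le> r"
      using net[of u] by auto
    have "vnorm m (mat_vec n B u) \<le> vnorm m (mat_vec n B y) + vnorm m (mat_vec n B (\<lambda>j. u j - y j))"
      using vnorm_triangle[of m "mat_vec n B y" "mat_vec n B (\<lambda>j. u j - y j)"] by (simp add: mat_vec_diff)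
    also have "\<dots> \<le> r + R * \<epsilon>"
      using y R(2) mult_left_mono[OF y(1) R(2)] bounded_operatorD[OF R(1), of "\<lambda>j. u j - y j"] by linarith
    finally show ?thesis
      using x by (simp add: u_def[abs_def] mat_vec_divide vnorm_divide pos_divide_le_eq mult.commute)
  qed
qed

text \<open>Starting from any bound on the operator norm, iterate \<open>R \<mapsto> r + \<epsilon> * R\<close>.\<close>

lemma bounded_operator_of_net:
  assumes \<epsilon>: "0 \<le> \<epsilon>" "\<epsilon> < 1" and r: "0 \<le> r"
    and net: "\<And>x. vnorm n x \<le> 1 \<Longrightarrow> \<exists>y. vnorm n (\<lambda>j. x j - y j) \<le> \<epsilon> \<and> vnorm m (mat_vec n B y) \<le> r"
  shows "bounded_operator m n (r / (1 - \<epsilon>)) B"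
proof -
  obtain R where R: "0 \<le> R" "bounded_operator m n R B" by (rule bounded_operator_exists)
  define b where "b k = r / (1 - \<epsilon>) + \<epsilon> ^ k * R" for k :: nat
  have b: "0 \<le> b k" for k using \<epsilon> r R by (simp add: b_def)
  have bounded: "bounded_operator m n (b k) B" for k
  proof (induction k)
    case 0
    have "R * vnorm n x \<le> b 0 * vnorm n x" for x using \<epsilon> r by (intro mult_right_mono) (auto simp: b_def)
    then show ?case using R(2) unfolding bounded_operator_def by (blast intro: order_trans)
  next
    case (Suc k)
    have "r + \<epsilon> * b k = b (Suc k)" using \<epsilon> by (simp add: b_def field_simps)
    with bounded_operator_improve[OF Suc b net] show ?case by simp
  qed
  have "b \<longlonglongrightarrow> r / (1 - \<epsilon>) + 0 * R"
    unfolding b_def using \<epsilon> by (intro tendsto_intros LIMSEQ_realpow_zero)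
  then have limit: "(\<lambda>k. b k * vnorm n x) \<longlonglongrightarrow> r / (1 - \<epsilon>) * vnorm n x" for x
    by (intro tendsto_mult_right) simp
  show ?thesis
    unfolding bounded_operator_def using bounded_operatorD[OF bounded] by (intro allI LIMSEQ_le_const[OF limit]) auto
qed

lemma mat_vec_near_kernel_le:
  assumes op: "bounded_operator m n R B" "0 \<le> R" and z: "z \<in> unit_kernel m n B"
    and near: "vnorm n (\<lambda>j. z j - x j) \<le> e"
  shows "vnorm m (mat_vec n B x) \<le> R * e"
proof -
  have "vnorm m (mat_vec n B x) = vnorm m (mat_vec n B (\<lambda>j. x j - z j))"
    unfolding mat_vec_diff using z by (intro vnorm_cong) (simp add: unit_kernel_def)
  also have "\<dots> \<le> R * vnorm n (\<lambda>j. x j - z j)" by (rule bounded_operatorD[OF op(1)])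
  also have "\<dots> \<le> R * e" using near op(2) vnorm_minus_commute[of n x z] by (intro mult_left_mono) auto
  finally show ?thesis .
qed

lemma scaled_int_ball_net:
  assumes n: "0 < n" and x: "vnorm n x \<le> 1"
  obtains p where "p \<in> int_ball n (5 / 2 * sqrt (real n))"
    "vnorm n (\<lambda>j. x j - of_int (p j) / (2 * sqrt (real n))) \<le> 1 / 4"
proof -
  define a where "a j = 2 * sqrt (real n) * x j" for j
  obtain p :: "nat \<Rightarrow> int" where p: "p \<in> {..<n} \<rightarrow>\<^sub>E UNIV"
    and "dist_lattice n a = vnorm n (\<lambda>j. a j - of_int (p j))"
    by (rule dist_lattice_attained)
  then have dist: "vnorm n (\<lambda>j. a j - of_int (p j)) \<le> sqrt (real n) / 2"
    using dist_lattice_le_half_sqrt[of n a] by simp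
  have "vnorm n a \<le> 2 * sqrt (real n)"
    using x mult_left_mono[of "vnorm n x" 1 "2 * sqrt (real n)"] by (simp add: a_def[abs_def] vnorm_scale)
  then have "vnorm n (\<lambda>j. of_int (p j)) \<le> 5 / 2 * sqrt (real n)"
    using vnorm_triangle_diff[of n a "\<lambda>j. a j - of_int (p j)"] dist by simp
  moreover have "vnorm n (\<lambda>j. x j - of_int (p j) / (2 * sqrt (real n))) \<le> 1 / 4"
  proof -
    have "vnorm n (\<lambda>j. x j - of_int (p j) / (2 * sqrt (real n)))
        = vnorm n (\<lambda>j. (a j - of_int (p j)) / (2 * sqrt (real n)))"
      using n by (intro vnorm_cong) (simp add: a_def field_simps)
    also have "\<dots> = vnorm n (\<lambda>j. a j - of_int (p j)) / (2 * sqrt (real n))"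
      using n by (simp add: vnorm_divide)
    also have "\<dots> \<le> 1 / 4" using dist n by (simp add: field_simps)
    finally show ?thesis .
  qed
  ultimately show thesis using p that by (simp add: int_ball_def)
qed

lemma bounded_operator_of_int_ball:
  assumes n: "0 < n" and r: "0 \<le> r"
    and int: "\<And>p. p \<in> int_ball n (5 / 2 * sqrt (real n)) \<Longrightarrow>
      vnorm m (mat_vec n B (\<lambda>j. of_int (p j) / (2 * sqrt (real n)))) \<le> r"
  shows "bounded_operator m n (4 / 3 * r) B"
proof -
  have "bounded_operator m n (r / (1 - 1 / 4)) B"
  proof (rule bounded_operator_of_net[OF _ _ r])
    fix x assume "vnorm n x \<le> 1"
    from scaled_int_ball_net[OF n this] int
    show "\<exists>y. vnorm n (\<lambda>j. x j - y j) \<le> 1 / 4 \<and> vnorm m (mat_vec n B y) \<le> r" by metis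
  qed auto
  then show ?thesis by (simp add: mult.commute)
qed

section \<open>Union bounds for outer measures\<close>

lemma outer_measure_of_UN_le:
  assumes "finite I" and A: "\<And>i. i \<in> I \<Longrightarrow> A i \<subseteq> space M"
  shows "outer_measure_of M (\<Union>i\<in>I. A i) \<le> (\<Sum>i\<in>I. outer_measure_of M (A i))"
proof -
  obtain E where E: "\<And>i. i \<in> I \<Longrightarrow> E i \<in> sets M \<and> A i \<subseteq> E i \<and> outer_measure_of M (A i) = emeasure M (E i)"
    using outer_measure_of_attain[OF A] by metis
  have "outer_measure_of M (\<Union>i\<in>I. A i) \<le> outer_measure_of M (\<Union>i\<in>I. E i)"
    using E by (intro outer_measure_of_mono) blast
  also have "\<dots> = emeasure M (\<Union>i\<in>I. E i)"
    using E \<open>finite I\<close> by (intro outer_measure_of_eq sets.finite_UN) auto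
  also have "\<dots> \<le> (\<Sum>i\<in>I. emeasure M (E i))"
    using E \<open>finite I\<close> by (intro emeasure_subadditive_finite) auto
  also have "\<dots> = (\<Sum>i\<in>I. outer_measure_of M (A i))"
    using E by (intro sum.cong) auto
  finally show ?thesis .
qed

lemma outer_measure_of_Un_le:
  assumes "A \<subseteq> space M" "B \<subseteq> space M"
  shows "outer_measure_of M (A \<union> B) \<le> outer_measure_of M A + outer_measure_of M B"
  using outer_measure_of_UN_le[of "{True, False}" "\<lambda>b. if b then A else B" M] assms by (simp add: Un_commute)

lemma outer_measure_of_UN_le_card:
  fixes c :: real
  assumes "finite I" "0 \<le> c" "\<And>i. i \<in> I \<Longrightarrow> A i \<subseteq> space M"
    and "\<And>i. i \<in> I \<Longrightarrow> outer_measure_of M (A i) \<le> ennreal c"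
  shows "outer_measure_of M (\<Union>i\<in>I. A i) \<le> ennreal (card I * c)"
proof -
  have "outer_measure_of M (\<Union>i\<in>I. A i) \<le> (\<Sum>i\<in>I. ennreal c)"
    using assms by (intro order_trans[OF outer_measure_of_UN_le] sum_mono) auto
  also have "\<dots> = ennreal (card I * c)"
    using assms(2) by (simp add: ennreal_mult ennreal_of_nat_eq_real_of_nat)
  finally show ?thesis .
qed

lemma (in prob_space) measurable_cover_of_outer_measure_le:
  assumes "A \<subseteq> space M" "outer_measure_of M A \<le> ennreal c" "0 \<le> c"
  shows "\<exists>E\<in>events. A \<subseteq> E \<and> prob E \<le> c"
proof -
  obtain E where "E \<in> events" "A \<subseteq> E" "outer_measure_of M A = emeasure M E"
    using outer_measure_of_attain[OF assms(1)] by blast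
  then show ?thesis using assms(2,3) by (intro bexI[of _ E]) (auto simp: emeasure_eq_measure)
qed

section \<open>Matrices with independent entries\<close>

context real_distribution
begin

abbreviation matrix_law :: "nat \<Rightarrow> nat \<Rightarrow> (nat \<times> nat \<Rightarrow> real) measure" where
  "matrix_law m n \<equiv> PiM ({..<m} \<times> {..<n}) (\<lambda>_. M)"

lemma nn_integral_prod_rows:
  assumes "finite I" and F: "\<And>i. i \<in> I \<Longrightarrow> F i \<in> borel_measurable (PiM J (\<lambda>_. M))"
  shows "(\<integral>\<^sup>+\<omega>. (\<Prod>i\<in>I. F i (\<lambda>j\<in>J. \<omega> (i, j))) \<partial>PiM (I \<times> J) (\<lambda>_. M)) = (\<Prod>i\<in>I. \<integral>\<^sup>+v. F i v \<partial>PiM J (\<lambda>_. M))"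
proof -
  let ?P = "PiM (I \<times> J) (\<lambda>_. M)"
  interpret P: prob_space ?P by (rule prob_space_PiM_const)
  have row_meas: "(\<lambda>\<omega>. \<lambda>j\<in>J. \<omega> (i, j)) \<in> PiM K (\<lambda>_. M) \<rightarrow>\<^sub>M PiM J (\<lambda>_. M)" if "{i} \<times> J \<subseteq> K" for i K
    using that by (intro measurable_restrict measurable_component_singleton) auto
  have "P.indep_vars (\<lambda>_. M) (\<lambda>k \<omega>. \<omega> k) (I \<times> J)"
    by (intro indep_vars_PiM_coordinates prob_space_axioms)
  then have "P.indep_vars (\<lambda>i. PiM ({i} \<times> J) (\<lambda>_. M)) (\<lambda>i \<omega>. restrict \<omega> ({i} \<times> J)) I"
    by (rule P.indep_vars_restrict) (auto simp: disjoint_family_on_def)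
  then have "P.indep_vars (\<lambda>_. borel) (\<lambda>i \<omega>. F i (\<lambda>j\<in>J. restrict \<omega> ({i} \<times> J) (i, j))) I"
    by (rule P.indep_vars_compose2) (rule measurable_compose[OF row_meas F], auto)
  then have indep: "P.indep_vars (\<lambda>_. borel) (\<lambda>i \<omega>. F i (\<lambda>j\<in>J. \<omega> (i, j))) I"
    by (simp cong: restrict_cong)
  have "(\<integral>\<^sup>+\<omega>. F i (\<lambda>j\<in>J. \<omega> (i, j)) \<partial>?P) = (\<integral>\<^sup>+v. F i v \<partial>PiM J (\<lambda>_. M))" if "i \<in> I" for i
  proof -
    have "distr ?P (PiM J (\<lambda>_. M)) (\<lambda>\<omega>. \<lambda>j\<in>J. \<omega> (i, j)) = PiM J (\<lambda>_. M)"
      using distr_PiM_reindex[of "I \<times> J" "\<lambda>_. M" "Pair i" J] that prob_space_axioms by (auto simp: inj_on_def)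
    then have "(\<integral>\<^sup>+v. F i v \<partial>PiM J (\<lambda>_. M)) = (\<integral>\<^sup>+v. F i v \<partial>distr ?P (PiM J (\<lambda>_. M)) (\<lambda>\<omega>. \<lambda>j\<in>J. \<omega> (i, j)))"
      by simp
    also have "\<dots> = (\<integral>\<^sup>+\<omega>. F i (\<lambda>j\<in>J. \<omega> (i, j)) \<partial>?P)"
      using that by (intro nn_integral_distr row_meas) (auto intro: F)
    finally show ?thesis by simp
  qed
  then show ?thesis
    using P.indep_vars_nn_integral[OF \<open>finite I\<close> indep] by simp
qed

lemma vnorm_mat_vec_measurable [measurable]:
  "(\<lambda>\<omega>. vnorm m (mat_vec n \<omega> x)) \<in> borel_measurable (matrix_law m n)"
proof -
  have [measurable]: "(\<lambda>\<omega>. \<omega> (i, j)) \<in> borel_measurable (matrix_law m n)" if "i < m" "j < n" for i j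
  proof -
    have "(i, j) \<in> {..<m} \<times> {..<n}" using that by simp
    then show ?thesis by measurable
  qed
  show ?thesis unfolding vnorm_def mat_vec_def by measurable
qed

lemma nn_integral_exp_mat_vec:
  "(\<integral>\<^sup>+\<omega>. ennreal (exp (l * (vnorm m (mat_vec n \<omega> x))\<^sup>2)) \<partial>matrix_law m n)
    = (\<integral>\<^sup>+s. ennreal (exp (l * s\<^sup>2)) \<partial>form_law n x) ^ m"
proof -
  define F where "F v = ennreal (exp (l * (\<Sum>j<n. x j * v j)\<^sup>2))" for v :: "nat \<Rightarrow> real"
  have F: "F \<in> borel_measurable (PiM {..<n} (\<lambda>_. M))" unfolding F_def by measurable
  have "(\<integral>\<^sup>+\<omega>. ennreal (exp (l * (vnorm m (mat_vec n \<omega> x))\<^sup>2)) \<partial>matrix_law m n)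
      = (\<integral>\<^sup>+\<omega>. (\<Prod>i<m. F (\<lambda>j\<in>{..<n}. \<omega> (i, j))) \<partial>matrix_law m n)"
    by (intro nn_integral_cong)
      (simp add: F_def vnorm_power2 mat_vec_def sum_distrib_left exp_sum prod_ennreal)
  also have "\<dots> = (\<Prod>i<m. \<integral>\<^sup>+v. F v \<partial>PiM {..<n} (\<lambda>_. M))"
    using F by (intro nn_integral_prod_rows) auto
  also have "\<dots> = (\<integral>\<^sup>+s. ennreal (exp (l * s\<^sup>2)) \<partial>form_law n x) ^ m"
    by (simp add: F_def nn_integral_form_law)
  finally show ?thesis .
qed

lemma mat_vec_lower_tail:
  assumes l: "0 < l" and laplace: "(\<integral>\<^sup>+s. ennreal (exp (- l * s\<^sup>2)) \<partial>form_law n x) \<le> ennreal q" and "0 \<le> q"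
  shows "emeasure (matrix_law m n) {\<omega> \<in> space (matrix_law m n). vnorm m (mat_vec n \<omega> x) \<le> r}
    \<le> ennreal (exp (l * r\<^sup>2) * q ^ m)"
proof -
  let ?P = "matrix_law m n"
  have "emeasure ?P {\<omega> \<in> space ?P. vnorm m (mat_vec n \<omega> x) \<le> r}
      \<le> emeasure ?P {\<omega> \<in> space ?P. (vnorm m (mat_vec n \<omega> x))\<^sup>2 \<le> r\<^sup>2}"
    by (rule emeasure_mono) (auto intro: power_mono)
  also have "\<dots> \<le> ennreal (exp (l * r\<^sup>2)) *
      (\<integral>\<^sup>+\<omega>. ennreal (exp (- l * (vnorm m (mat_vec n \<omega> x))\<^sup>2)) * indicator (space ?P) \<omega> \<partial>?P)"
    using l by (intro Chernoff_ineq_nn_integral_le) auto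
  also have "(\<integral>\<^sup>+\<omega>. ennreal (exp (- l * (vnorm m (mat_vec n \<omega> x))\<^sup>2)) * indicator (space ?P) \<omega> \<partial>?P)
      = (\<integral>\<^sup>+s. ennreal (exp (- l * s\<^sup>2)) \<partial>form_law n x) ^ m"
    unfolding nn_integral_exp_mat_vec[symmetric] by (intro nn_integral_cong) simp
  also have "\<dots> \<le> ennreal q ^ m" by (intro power_mono laplace) simp
  finally show ?thesis using \<open>0 \<le> q\<close> by (simp add: ennreal_power ennreal_mult mult_left_mono)
qed

lemma mat_vec_upper_tail:
  assumes l: "0 < l" and laplace: "(\<integral>\<^sup>+s. ennreal (exp (l * s\<^sup>2)) \<partial>form_law n x) \<le> ennreal q"
    and "0 \<le> q" "0 \<le> r"
  shows "emeasure (matrix_law m n) {\<omega> \<in> space (matrix_law m n). r \<le> vnorm m (mat_vec n \<omega> x)}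
    \<le> ennreal (exp (- l * r\<^sup>2) * q ^ m)"
proof -
  let ?P = "matrix_law m n"
  have "emeasure ?P {\<omega> \<in> space ?P. r \<le> vnorm m (mat_vec n \<omega> x)}
      \<le> emeasure ?P {\<omega> \<in> space ?P. r\<^sup>2 \<le> (vnorm m (mat_vec n \<omega> x))\<^sup>2}"
    using \<open>0 \<le> r\<close> by (intro emeasure_mono) (auto intro: power_mono)
  also have "\<dots> \<le> ennreal (exp (- l * r\<^sup>2)) *
      (\<integral>\<^sup>+\<omega>. ennreal (exp (l * (vnorm m (mat_vec n \<omega> x))\<^sup>2)) * indicator (space ?P) \<omega> \<partial>?P)"
    using l by (intro Chernoff_ineq_nn_integral_ge) auto
  also have "(\<integral>\<^sup>+\<omega>. ennreal (exp (l * (vnorm m (mat_vec n \<omega> x))\<^sup>2)) * indicator (space ?P) \<omega> \<partial>?P)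
      = (\<integral>\<^sup>+s. ennreal (exp (l * s\<^sup>2)) \<partial>form_law n x) ^ m"
    unfolding nn_integral_exp_mat_vec[symmetric] by (intro nn_integral_cong) simp
  also have "\<dots> \<le> ennreal q ^ m" by (intro power_mono laplace) simp
  finally show ?thesis using \<open>0 \<le> q\<close> by (simp add: ennreal_power ennreal_mult mult_left_mono)
qed

definition kernel_LCD_event :: "nat \<Rightarrow> nat \<Rightarrow> real \<Rightarrow> real \<Rightarrow> real \<Rightarrow> ereal set \<Rightarrow> (nat \<times> nat \<Rightarrow> real) set" where
  "kernel_LCD_event m n R \<gamma> \<alpha> I = {\<omega> \<in> space (matrix_law m n).
    bounded_operator m n R \<omega> \<and> (\<exists>z\<in>unit_kernel m n \<omega>. LCD n \<gamma> \<alpha> z \<in> I)}"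

abbreviation kernel_LCD_prob :: "nat \<Rightarrow> nat \<Rightarrow> real \<Rightarrow> real \<Rightarrow> real \<Rightarrow> ereal set \<Rightarrow> ennreal" where
  "kernel_LCD_prob m n R \<gamma> \<alpha> I \<equiv> outer_measure_of (matrix_law m n) (kernel_LCD_event m n R \<gamma> \<alpha> I)"

lemma kernel_LCD_event_subset_space: "kernel_LCD_event m n R \<gamma> \<alpha> I \<subseteq> space (matrix_law m n)"
  by (auto simp: kernel_LCD_event_def)

lemma outer_measure_kernel_LCD_event_le:
  assumes laplace: "\<And>z. \<lbrakk>vnorm n z = 1; LCD n \<gamma> \<alpha> z \<in> I\<rbrakk> \<Longrightarrow>
      (\<integral>\<^sup>+s. ennreal (exp (- l * s\<^sup>2)) \<partial>form_law n z) \<le> ennreal q"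
    and denominator: "\<And>z. \<lbrakk>vnorm n z = 1; LCD n \<gamma> \<alpha> z \<in> I\<rbrakk> \<Longrightarrow>
      \<exists>\<theta>. 0 < \<theta> \<and> \<theta> < b \<and> dist_lattice n (\<lambda>j. \<theta> * z j) < \<epsilon> * \<theta>"
    and pos: "\<epsilon> \<le> 1" "0 < l" "0 \<le> q" "0 \<le> R"
  shows "kernel_LCD_prob m n R \<gamma> \<alpha> I
    \<le> ennreal (card (int_ball n (2 * b)) * (exp (l * (R * (4 * \<epsilon>))\<^sup>2) * q ^ m))"
proof -
  let ?P = "matrix_law m n"
  let ?r = "R * (4 * \<epsilon>)"
  define S where "S = {z. vnorm n z = 1 \<and> LCD n \<gamma> \<alpha> z \<in> I}"
  obtain T where T: "T \<subseteq> S" "finite T" "card T \<le> card (int_ball n (2 * b))"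
    and net: "\<And>z. z \<in> S \<Longrightarrow> \<exists>x\<in>T. vnorm n (\<lambda>j. z j - x j) \<le> 4 * \<epsilon>"
    by (rule finite_net_of_approximate_denominators[of S n b \<epsilon>]) (use denominator pos(1) in \<open>auto simp: S_def\<close>)
  define small where "small x = {\<omega> \<in> space ?P. vnorm m (mat_vec n \<omega> x) \<le> ?r}" for x
  have small_sets: "small x \<in> sets ?P" for x unfolding small_def by measurable
  have "outer_measure_of ?P (small x) \<le> ennreal (exp (l * ?r\<^sup>2) * q ^ m)" if "x \<in> T" for x
    using mat_vec_lower_tail[OF pos(2) laplace pos(3), of x] small_sets T(1) that
    by (auto simp: small_def S_def)
  then have union: "outer_measure_of ?P (\<Union>x\<in>T. small x) \<le> ennreal (card T * (exp (l * ?r\<^sup>2) * q ^ m))"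
    using T(2) pos(3) by (intro outer_measure_of_UN_le_card) (auto simp: small_def)
  have "kernel_LCD_event m n R \<gamma> \<alpha> I \<subseteq> (\<Union>x\<in>T. small x)"
  proof
    fix \<omega> assume \<omega>: "\<omega> \<in> kernel_LCD_event m n R \<gamma> \<alpha> I"
    then obtain z where z: "z \<in> unit_kernel m n \<omega>" "z \<in> S"
      by (auto simp: kernel_LCD_event_def unit_kernel_def S_def)
    obtain x where x: "x \<in> T" "vnorm n (\<lambda>j. z j - x j) \<le> 4 * \<epsilon>" using net[OF z(2)] by blast
    have "vnorm m (mat_vec n \<omega> x) \<le> ?r"
      using \<omega> pos(4) z(1) x(2) by (intro mat_vec_near_kernel_le) (auto simp: kernel_LCD_event_def)
    then show "\<omega> \<in> (\<Union>x\<in>T. small x)" using \<omega> x(1) by (auto simp: small_def kernel_LCD_event_def)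
  qed
  then have "outer_measure_of ?P (kernel_LCD_event m n R \<gamma> \<alpha> I) \<le> outer_measure_of ?P (\<Union>x\<in>T. small x)"
    by (rule outer_measure_of_mono)
  also note union
  also have "ennreal (card T * (exp (l * ?r\<^sup>2) * q ^ m))
      \<le> ennreal (card (int_ball n (2 * b)) * (exp (l * ?r\<^sup>2) * q ^ m))"
    using T(3) pos(3) by (intro ennreal_leI mult_right_mono) auto
  finally show ?thesis .
qed

lemma nn_integral_exp_square_form_law_le_2:
  assumes proxy: "variance_proxy M V" and x: "vnorm n x \<le> 5 / 4"
  shows "(\<integral>\<^sup>+s. ennreal (exp (1 / (5 * (V + 1)) * s\<^sup>2)) \<partial>form_law n x) \<le> ennreal 2"
proof -
  interpret form: real_distribution "form_law n x" by (rule real_distribution_form_law)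
  have V: "0 \<le> V" by (rule variance_proxyD(1)[OF proxy])
  let ?l = "1 / (5 * (V + 1))"
  let ?V = "V * (vnorm n x)\<^sup>2"
  have "(vnorm n x)\<^sup>2 \<le> (5 / 4)\<^sup>2" using x by (intro power_mono) auto
  then have "?V * ?l \<le> V * (5 / 4)\<^sup>2 * ?l" using V by (intro mult_right_mono mult_left_mono) auto
  also have "\<dots> \<le> 5 / 16" using V by (simp add: field_simps power2_eq_square)
  finally have le: "2 * (?V * ?l) \<le> 5 / 8" by linarith
  then have "2 * (?V * ?l) < 1" "0 \<le> ?l" using V by (linarith, simp)
  then have "(\<integral>\<^sup>+s. ennreal (exp (?l * s\<^sup>2)) \<partial>form_law n x) \<le> ennreal (1 / sqrt (1 - 2 * (?V * ?l)))"
    by (intro form.nn_integral_exp_square_le_variance_proxy variance_proxy_form_law proxy)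
  also have "\<dots> \<le> ennreal (1 / sqrt ((1 / 2)\<^sup>2))"
    using le by (intro ennreal_leI divide_left_mono real_sqrt_le_mono) (auto simp: power2_eq_square)
  finally show ?thesis by simp
qed

lemma large_image_of_scaled_int_ball_rare:
  fixes V :: real
  assumes proxy: "variance_proxy M V" and mn: "m \<le> n" "0 < n"
  defines "r \<equiv> sqrt (30 * (V + 1)) * sqrt (real n)"
  shows "outer_measure_of (matrix_law m n) (\<Union>p\<in>int_ball n (5 / 2 * sqrt (real n)).
      {\<omega> \<in> space (matrix_law m n). r \<le> vnorm m (mat_vec n \<omega> (\<lambda>j. of_int (p j) / (2 * sqrt (real n))))})
    \<le> ennreal (exp (- real n))"
proof -
  let ?P = "matrix_law m n"
  let ?N = "int_ball n (5 / 2 * sqrt (real n))"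
  let ?l = "1 / (5 * (V + 1))"
  define y where "y p j = real_of_int (p j) / (2 * sqrt (real n))" for p :: "nat \<Rightarrow> int" and j
  define large where "large p = {\<omega> \<in> space ?P. r \<le> vnorm m (mat_vec n \<omega> (y p))}" for p
  have large_sets: "large p \<in> sets ?P" for p unfolding large_def by measurable
  have V: "0 \<le> V" by (rule variance_proxyD(1)[OF proxy])
  have l: "0 < ?l" using V by simp
  have r: "0 \<le> r" "?l * r\<^sup>2 = 6 * real n" using V by (simp_all add: r_def power_mult_distrib field_simps)
  have "outer_measure_of ?P (large p) \<le> ennreal (exp (- (6 * real n)) * 2 ^ m)" if "p \<in> ?N" for p
  proof -
    have "vnorm n (y p) \<le> 5 / 4"
      using that mn(2) by (simp add: y_def[abs_def] vnorm_divide int_ball_def field_simps)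
    from mat_vec_upper_tail[OF l nn_integral_exp_square_form_law_le_2[OF proxy this] _ r(1), of m]
    have "emeasure ?P (large p) \<le> ennreal (exp (- (?l * r\<^sup>2)) * 2 ^ m)" by (simp add: large_def)
    then show ?thesis using large_sets by (simp only: r outer_measure_of_eq)
  qed
  then have "outer_measure_of ?P (\<Union>p\<in>?N. large p) \<le> ennreal (card ?N * (exp (- (6 * real n)) * 2 ^ m))"
    by (intro outer_measure_of_UN_le_card finite_int_ball) (auto simp: large_def)
  also have "\<dots> \<le> ennreal (exp (- real n))"
    by (intro ennreal_leI card_int_ball_mult_le_exp mn(1))
  finally show ?thesis by (simp add: large_def y_def[abs_def])
qed

lemma unbounded_operator_rare:
  assumes proxy: "variance_proxy M V" and mn: "m \<le> n" "0 < n"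
  shows "outer_measure_of (matrix_law m n)
      {\<omega> \<in> space (matrix_law m n). \<not> bounded_operator m n (4 / 3 * sqrt (30 * (V + 1)) * sqrt (real n)) \<omega>}
    \<le> ennreal (exp (- real n))"
proof (rule order_trans[OF outer_measure_of_mono large_image_of_scaled_int_ball_rare[OF assms]], safe, rule ccontr)
  fix \<omega>
  let ?r = "sqrt (30 * (V + 1)) * sqrt (real n)"
  assume \<omega>: "\<omega> \<in> space (matrix_law m n)"
    and unbounded: "\<not> bounded_operator m n (4 / 3 * sqrt (30 * (V + 1)) * sqrt (real n)) \<omega>"
    and small: "\<omega> \<notin> (\<Union>p\<in>int_ball n (5 / 2 * sqrt (real n)).
      {\<omega> \<in> space (matrix_law m n). ?r \<le> vnorm m (mat_vec n \<omega> (\<lambda>j. of_int (p j) / (2 * sqrt (real n))))})"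
  have "0 \<le> ?r" using variance_proxyD(1)[OF proxy] by simp
  with small \<omega> have "bounded_operator m n (4 / 3 * ?r) \<omega>"
    by (intro bounded_operator_of_int_ball mn(2)) (auto simp: not_le less_imp_le)
  with unbounded show False by (simp add: mult.assoc)
qed

end

section \<open>The essential LCD of kernel vectors\<close>

lemma eventually_le_mult_sqrt:
  assumes "0 < a"
  shows "\<forall>\<^sub>F n in sequentially. x \<le> a * sqrt (real n)"
proof -
  have "filterlim (\<lambda>n. a * sqrt (real n)) at_top sequentially"
    using assms
    by (intro filterlim_tendsto_pos_mult_at_top[OF tendsto_const]
        filterlim_compose[OF sqrt_at_top filterlim_real_sequentially])
  then show ?thesis by (simp add: filterlim_at_top)
qed

lemma eventually_mult_exp_le:
  assumes "0 < a"
  shows "\<forall>\<^sub>F n in sequentially. H * exp (- (2 * a * real n)) \<le> exp (- (a * real n))"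
proof -
  have "\<forall>\<^sub>F n in sequentially. H / a \<le> real n"
    using filterlim_real_sequentially by (simp add: filterlim_at_top)
  then show ?thesis
  proof eventually_elim
    case (elim n)
    then have "H \<le> a * real n" using assms by (simp add: field_simps)
    then have "H \<le> exp (a * real n)" using exp_ge_add_one_self[of "a * real n"] by linarith
    then have "H * exp (- (2 * a * real n)) \<le> exp (a * real n) * exp (- (2 * a * real n))"
      by (intro mult_right_mono) auto
    also have "\<dots> = exp (- (a * real n))" by (simp flip: exp_add)
    finally show ?case .
  qed
qed

lemma eventually_exponentials_le:
  fixes a \<delta> y C :: real
  assumes a: "0 < a" "2 * a \<le> \<delta>" "2 * a \<le> 1" and C: "0 \<le> C"
  shows "\<forall>\<^sub>F n in sequentially. exp (- real n) + exp (y - \<delta> * real n) + C * exp (- real n) \<le> exp (- a * real n)"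
  using eventually_mult_exp_le[OF a(1), of "1 + exp y + C"]
proof eventually_elim
  case (elim n)
  have "exp (- real n) \<le> exp (- (2 * a * real n))"
    using mult_right_mono[OF a(3), of "real n"] by simp
  moreover from this have "C * exp (- real n) \<le> C * exp (- (2 * a * real n))"
    using C by (intro mult_left_mono) auto
  moreover have "exp (y - \<delta> * real n) \<le> exp y * exp (- (2 * a * real n))"
    using mult_right_mono[OF a(2), of "real n"] by (simp flip: exp_add)
  ultimately have "exp (- real n) + exp (y - \<delta> * real n) + C * exp (- real n)
      \<le> (1 + exp y + C) * exp (- (2 * a * real n))"
    unfolding distrib_right by linarith
  also have "\<dots> \<le> exp (- a * real n)" using elim by simp
  finally show ?case .
qed

lemma ereal_interval_subset_dyadic:
  fixes a b :: real
  assumes "0 < a" "b \<le> a * 2 ^ N"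
  shows "{ereal a..<ereal b} \<subseteq> (\<Union>k\<in>{k. k < N \<and> a * 2 ^ k \<le> b}. {ereal (a * 2 ^ k)..<ereal (2 * (a * 2 ^ k))})"
proof
  fix y assume y: "y \<in> {ereal a..<ereal b}"
  then obtain x where x: "y = ereal x" "a \<le> x" "x < b" by (cases y) auto
  define k where "k = (LEAST k. x < a * 2 ^ Suc k)"
  obtain j where "x / a < 2 ^ j" using real_arch_pow[of 2 "x / a"] by auto
  also have "(2::real) ^ j \<le> 2 ^ Suc j" by simp
  finally have "x < a * 2 ^ Suc j" using assms(1) by (simp add: field_simps)
  then have upper: "x < a * 2 ^ Suc k" unfolding k_def by (rule LeastI)
  have lower: "a * 2 ^ k \<le> x"
  proof (cases k)
    case 0
    then show ?thesis using x by simp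
  next
    case (Suc l)
    then have "\<not> x < a * 2 ^ Suc l" unfolding k_def by (intro not_less_Least) simp
    then show ?thesis using Suc by simp
  qed
  have "a * 2 ^ k < a * 2 ^ N" using lower x(3) assms(2) by linarith
  then have "k < N" using assms(1) by simp
  then show "y \<in> (\<Union>k\<in>{k. k < N \<and> a * 2 ^ k \<le> b}. {ereal (a * 2 ^ k)..<ereal (2 * (a * 2 ^ k))})"
    using upper lower x by (intro UN_I[of k]) (auto simp: mult_ac)
qed

context real_distribution
begin

lemma kernel_LCD_level_le:
  assumes laplace: "\<And>x. \<lbrakk>vnorm n x = 1; ereal D \<le> LCD n \<gamma> \<alpha> x\<rbrakk> \<Longrightarrow>
      (\<integral>\<^sup>+s. ennreal (exp (- (s / t)\<^sup>2 / 2)) \<partial>form_law n x) \<le> ennreal q"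
    and t: "t = 4 * K * \<alpha> / D"
    and pos: "0 < n" "0 < D" "0 < \<alpha>" "0 < \<gamma>" "\<gamma> \<le> 1" "0 < K" "0 \<le> q"
  shows "kernel_LCD_prob m n (K * sqrt (real n)) \<gamma> \<alpha> {ereal D..<ereal (2 * D)}
    \<le> ennreal (exp (real n) * (1 + 8 * (D / sqrt (real n))) ^ n * (exp (real n / 2) * q ^ m))"
proof -
  define \<epsilon> where "\<epsilon> = min \<gamma> (\<alpha> / D)"
  define l where "l = 1 / (2 * t\<^sup>2)"
  have \<epsilon>: "0 \<le> \<epsilon>" "\<epsilon> \<le> 1" "4 * \<epsilon> \<le> 4 * (\<alpha> / D)" using pos by (auto simp: \<epsilon>_def)
  have "0 < t" using pos by (simp add: t)
  then have l: "0 < l" "l * (t\<^sup>2 * real n) = real n / 2" by (auto simp: l_def)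
  have "K * sqrt (real n) * (4 * \<epsilon>) \<le> K * sqrt (real n) * (4 * (\<alpha> / D))"
    using pos \<epsilon>(3) by (intro mult_left_mono) auto
  also have "\<dots> = t * sqrt (real n)" by (simp add: t)
  finally have "(K * sqrt (real n) * (4 * \<epsilon>))\<^sup>2 \<le> (t * sqrt (real n))\<^sup>2"
    using \<epsilon> pos by (intro power_mono) auto
  also have "\<dots> = t\<^sup>2 * real n" by (simp add: power_mult_distrib)
  finally have "l * (K * sqrt (real n) * (4 * \<epsilon>))\<^sup>2 \<le> l * (t\<^sup>2 * real n)"
    using l(1) by (intro mult_left_mono) auto
  then have exponent: "l * (K * sqrt (real n) * (4 * \<epsilon>))\<^sup>2 \<le> real n / 2" unfolding l(2) .
  have "0 < sqrt (real n) / (4 * D)" using pos by simp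
  from card_int_ball_le_sqrt[OF this, of n "2 * (2 * D)"]
  have card: "real (card (int_ball n (2 * (2 * D)))) \<le> exp (real n) * (1 + 8 * (D / sqrt (real n))) ^ n"
    using pos by (simp add: field_simps)
  have "kernel_LCD_prob m n (K * sqrt (real n)) \<gamma> \<alpha> {ereal D..<ereal (2 * D)}
      \<le> ennreal (card (int_ball n (2 * (2 * D))) * (exp (l * (K * sqrt (real n) * (4 * \<epsilon>))\<^sup>2) * q ^ m))"
  proof (rule outer_measure_kernel_LCD_event_le)
    fix z assume z: "vnorm n z = 1" "LCD n \<gamma> \<alpha> z \<in> {ereal D..<ereal (2 * D)}"
    show "(\<integral>\<^sup>+s. ennreal (exp (- l * s\<^sup>2)) \<partial>form_law n z) \<le> ennreal q"
      using laplace[of z] z by (simp add: l_def power_divide mult.commute)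
    show "\<exists>\<theta>. 0 < \<theta> \<and> \<theta> < 2 * D \<and> dist_lattice n (\<lambda>j. \<theta> * z j) < \<epsilon> * \<theta>"
      using approximate_denominator_of_LCD_level[OF z(1), of D \<gamma> \<alpha>] z(2) pos by (auto simp: \<epsilon>_def)
  qed (use pos \<epsilon>(2) l(1) in auto)
  also have "\<dots> \<le> ennreal (exp (real n) * (1 + 8 * (D / sqrt (real n))) ^ n * (exp (real n / 2) * q ^ m))"
    using card exponent pos by (intro ennreal_leI mult_mono) auto
  finally show ?thesis .
qed

lemma kernel_LCD_dyadic_le:
  assumes "0 < a" "b \<le> a * 2 ^ N" "0 \<le> q"
    and level: "\<And>D. \<lbrakk>a \<le> D; D \<le> b\<rbrakk> \<Longrightarrow>
      kernel_LCD_prob m n R \<gamma> \<alpha> {ereal D..<ereal (2 * D)} \<le> ennreal q"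
  shows "kernel_LCD_prob m n R \<gamma> \<alpha> {ereal a..<ereal b} \<le> ennreal (N * q)"
proof -
  let ?E = "kernel_LCD_event m n R \<gamma> \<alpha>"
  define I where "I = {k. k < N \<and> a * 2 ^ k \<le> b}"
  have I: "finite I" "card I \<le> N"
    using card_mono[of "{..<N}" I] by (auto simp: I_def)
  have "?E {ereal a..<ereal b} \<subseteq> (\<Union>k\<in>I. ?E {ereal (a * 2 ^ k)..<ereal (2 * (a * 2 ^ k))})"
    using ereal_interval_subset_dyadic[OF assms(1,2)] unfolding kernel_LCD_event_def I_def by blast
  then have "outer_measure_of (matrix_law m n) (?E {ereal a..<ereal b})
      \<le> outer_measure_of (matrix_law m n) (\<Union>k\<in>I. ?E {ereal (a * 2 ^ k)..<ereal (2 * (a * 2 ^ k))})"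
    by (rule outer_measure_of_mono)
  also have "\<dots> \<le> ennreal (card I * q)"
  proof (rule outer_measure_of_UN_le_card[OF I(1) assms(3) kernel_LCD_event_subset_space])
    fix k assume "k \<in> I"
    moreover have "a \<le> a * 2 ^ k" using assms(1) mult_left_mono[of 1 "2 ^ k" a] by simp
    ultimately show "outer_measure_of (matrix_law m n) (?E {ereal (a * 2 ^ k)..<ereal (2 * (a * 2 ^ k))}) \<le> ennreal q"
      by (intro level) (auto simp: I_def)
  qed
  also have "\<dots> \<le> ennreal (N * q)"
    using I(2) assms(3) by (intro ennreal_leI mult_right_mono) auto
  finally show ?thesis .
qed

lemma kernel_LCD_less_le:
  "outer_measure_of (matrix_law m n) {\<omega> \<in> space (matrix_law m n). \<exists>z\<in>unit_kernel m n \<omega>. LCD n \<gamma> \<alpha> z < ereal b}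
    \<le> outer_measure_of (matrix_law m n) {\<omega> \<in> space (matrix_law m n). \<not> bounded_operator m n R \<omega>}
      + (kernel_LCD_prob m n R \<gamma> \<alpha> {..<ereal a} + kernel_LCD_prob m n R \<gamma> \<alpha> {ereal a..<ereal b})"
proof -
  let ?P = "matrix_law m n"
  let ?U = "{\<omega> \<in> space ?P. \<not> bounded_operator m n R \<omega>}"
  let ?E = "kernel_LCD_event m n R \<gamma> \<alpha>"
  have "{\<omega> \<in> space ?P. \<exists>z\<in>unit_kernel m n \<omega>. LCD n \<gamma> \<alpha> z < ereal b}
      \<subseteq> ?U \<union> (?E {..<ereal a} \<union> ?E {ereal a..<ereal b})"
    by (force simp: kernel_LCD_event_def)
  then have "outer_measure_of ?P {\<omega> \<in> space ?P. \<exists>z\<in>unit_kernel m n \<omega>. LCD n \<gamma> \<alpha> z < ereal b}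
      \<le> outer_measure_of ?P (?U \<union> (?E {..<ereal a} \<union> ?E {ereal a..<ereal b}))"
    by (rule outer_measure_of_mono)
  also have "\<dots> \<le> outer_measure_of ?P ?U
      + (outer_measure_of ?P (?E {..<ereal a}) + outer_measure_of ?P (?E {ereal a..<ereal b}))"
    using kernel_LCD_event_subset_space
    by (intro order_trans[OF outer_measure_of_Un_le] add_left_mono outer_measure_of_Un_le) auto
  finally show ?thesis .
qed

end

lemma level_union_bound:
  fixes w A G :: real
  assumes "0 < n" and w: "0 < w" "w \<le> exp (real n)" and A: "0 < A" "A * G = exp (- 5)"
  shows "exp (real n) * (A * w) ^ n * (exp (real n / 2) * (G / w) ^ (n - 1)) \<le> A * exp 5 * exp (- 2 * real n)"
proof -
  have "(A * w) ^ n * (G / w) ^ (n - 1) = A * w * (A * w * (G / w)) ^ (n - 1)"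
    using \<open>0 < n\<close> by (cases n) (simp_all add: mult.assoc flip: power_mult_distrib)
  also have "A * w * (G / w) = exp (- 5)" using w A by simp
  also have "exp (- 5) ^ (n - 1) = exp (5 - 5 * real n :: real)"
    using \<open>0 < n\<close> by (simp add: of_nat_diff algebra_simps flip: exp_of_nat_mult)
  finally have powers: "(A * w) ^ n * (G / w) ^ (n - 1) = A * w * exp (5 - 5 * real n)" .
  have "exp (real n) * (A * w) ^ n * (exp (real n / 2) * (G / w) ^ (n - 1))
      = exp (real n) * exp (real n / 2) * ((A * w) ^ n * (G / w) ^ (n - 1))" by simp
  also have "\<dots> \<le> exp (real n) * exp (real n / 2) * (A * exp (real n) * exp (5 - 5 * real n))"
    unfolding powers using w A by (intro mult_left_mono mult_right_mono) auto
  also have "\<dots> = A * exp (5 - 5 / 2 * real n)"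
    by (simp add: field_simps flip: exp_add)
  also have "\<dots> \<le> A * exp (5 + - 2 * real n)" using A by (intro mult_left_mono) auto
  finally show ?thesis by (simp only: exp_add mult.assoc)
qed

lemma divide_plus_exp_minus_le:
  fixes t \<gamma> D y :: real
  assumes "0 < \<gamma>" "\<gamma> \<le> 1" "0 < D" "D \<le> exp y" "1 / D \<le> t"
  shows "t / \<gamma> + exp (- y) \<le> 2 * (t / \<gamma>)"
proof -
  have "0 < t" using assms(3) by (intro less_le_trans[OF _ assms(5)]) simp
  have "exp (- y) \<le> 1 / D" using assms by (simp add: exp_minus inverse_eq_divide divide_left_mono)
  also have "1 / D \<le> t" by fact
  also have "t \<le> t / \<gamma>" using assms \<open>0 < t\<close> divide_left_mono[of \<gamma> 1 t] by simp
  finally show ?thesis by simp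
qed

locale standardized_subgaussian = standardized_distribution +
  fixes V :: real
  assumes proxy: "variance_proxy M V"
begin

lemma small_LCD_le:
  assumes Q: "Q = 512 * exp (V / 2)" and \<delta>: "\<delta> = 1 / (8 * Q)"
    and \<gamma>: "0 < \<gamma>" "\<gamma> \<le> 1" "4 * \<gamma> * K \<le> sqrt \<delta>" and "0 < K" "0 < n"
  shows "kernel_LCD_prob (n - 1) n (K * sqrt (real n)) \<gamma> \<alpha> {..<ereal (\<delta> / 4 * sqrt (real n))}
    \<le> ennreal (exp (4 * \<delta> - \<delta> * real n))" (is "?lhs \<le> _")
proof -
  let ?r = "K * sqrt (real n) * (4 * \<gamma>)"
  have "1 \<le> exp (V / 2)" using variance_proxyD(1)[OF proxy] by simp
  then have "1 \<le> Q" unfolding Q by linarith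
  then have \<delta>_pos: "0 < \<delta>" by (simp add: \<delta>)
  have q: "0 \<le> 1 - 1 / (2 * Q)" "1 - 1 / (2 * Q) \<le> exp (- (4 * \<delta>))"
    using \<open>1 \<le> Q\<close> exp_ge_add_one_self[of "- (4 * \<delta>)"] by (simp_all add: \<delta> field_simps)
  have "\<exists>\<theta>. 0 < \<theta> \<and> \<theta> < \<delta> / 4 * sqrt (real n) \<and> dist_lattice n (\<lambda>j. \<theta> * z j) < \<gamma> * \<theta>"
    if "vnorm n z = 1" "LCD n \<gamma> \<alpha> z \<in> {..<ereal (\<delta> / 4 * sqrt (real n))}" for z
    using approximate_denominator_of_LCD_less[OF that(1), of \<gamma> \<alpha> "\<delta> / 4 * sqrt (real n)"] that(2) by auto
  then have "?lhs \<le> ennreal (card (int_ball n (2 * (\<delta> / 4 * sqrt (real n)))) *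
      (exp (1 / Q * ?r\<^sup>2) * (1 - 1 / (2 * Q)) ^ (n - 1)))"
    using \<open>1 \<le> Q\<close> q \<gamma> \<open>0 < K\<close> form_law_laplace_lt_1[OF proxy, folded Q]
    by (intro outer_measure_kernel_LCD_event_le) auto
  also have "\<dots> \<le> ennreal (exp (2 * \<delta> * real n) * (exp (\<delta> * real n) * exp (4 * \<delta> - 4 * \<delta> * real n)))"
  proof (intro ennreal_leI mult_mono)
    show "real (card (int_ball n (2 * (\<delta> / 4 * sqrt (real n))))) \<le> exp (2 * \<delta> * real n)"
      using card_small_int_ball_le_exp[OF \<delta>_pos, of n] by simp
    have "(4 * \<gamma> * K)\<^sup>2 \<le> (sqrt \<delta>)\<^sup>2" using \<gamma> \<open>0 < K\<close> by (intro power_mono) auto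
    then have "(4 * \<gamma> * K)\<^sup>2 * real n \<le> \<delta> * real n" using \<delta>_pos by (intro mult_right_mono) auto
    then have "?r\<^sup>2 \<le> \<delta> * real n" by (simp add: power_mult_distrib mult_ac)
    moreover have "1 / Q * ?r\<^sup>2 \<le> 1 * ?r\<^sup>2" using \<open>1 \<le> Q\<close> by (intro mult_right_mono) auto
    ultimately show "exp (1 / Q * ?r\<^sup>2) \<le> exp (\<delta> * real n)" by simp
    have "(1 - 1 / (2 * Q)) ^ (n - 1) \<le> exp (- (4 * \<delta>)) ^ (n - 1)" using q by (intro power_mono)
    also have "\<dots> = exp (4 * \<delta> - 4 * \<delta> * real n)"
      using \<open>0 < n\<close> by (simp add: of_nat_diff algebra_simps flip: exp_of_nat_mult)
    finally show "(1 - 1 / (2 * Q)) ^ (n - 1) \<le> exp (4 * \<delta> - 4 * \<delta> * real n)" .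
  qed (use q in auto)
  also have "\<dots> = ennreal (exp (4 * \<delta> - \<delta> * real n))" by (simp flip: exp_add)
  finally show ?thesis .
qed

lemma small_LCD_rare:
  assumes K: "0 < K"
  obtains \<delta> c\<^sub>0 \<gamma> where "0 < \<delta>" "0 < c\<^sub>0" "0 < \<gamma>" "\<gamma> < 1"
    "\<And>n \<alpha>. 0 < n \<Longrightarrow> kernel_LCD_prob (n - 1) n (K * sqrt (real n)) \<gamma> \<alpha> {..<ereal (c\<^sub>0 * sqrt (real n))}
      \<le> ennreal (exp (4 * \<delta> - \<delta> * real n))"
proof -
  define \<delta> where "\<delta> = 1 / (8 * (512 * exp (V / 2)))"
  define \<gamma> where "\<gamma> = min (1 / 2) (sqrt \<delta> / (4 * K))"
  have \<delta>: "0 < \<delta>" by (simp add: \<delta>_def)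
  then have \<gamma>: "0 < \<gamma>" "\<gamma> < 1" using K by (auto simp: \<gamma>_def min_def)
  have "4 * \<gamma> * K \<le> sqrt \<delta>" using K by (simp add: \<gamma>_def min_def field_simps)
  with \<delta> \<gamma> K show thesis by (intro that[of \<delta> "\<delta> / 4" \<gamma>] small_LCD_le[OF refl \<delta>_def]) auto
qed

lemma kernel_LCD_level_le_exp:
  assumes laplace: "\<And>x. \<lbrakk>vnorm n x = 1; ereal D \<le> LCD n \<gamma> \<alpha> x; 1 / D \<le> t\<rbrakk> \<Longrightarrow>
      (\<integral>\<^sup>+s. ennreal (exp (- (s / t)\<^sup>2 / 2)) \<partial>form_law n x) \<le> ennreal (B * (t / \<gamma> + exp (- \<kappa> * \<alpha>\<^sup>2)))"
    and \<alpha>: "\<alpha> = \<beta> * sqrt (real n)" and t: "t = 4 * K * \<alpha> / D"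
    and A: "A = 8 + 1 / c\<^sub>0" "A * (8 * B * K * \<beta> / \<gamma>) = exp (- 5)"
    and c: "c \<le> 1" "c \<le> \<kappa> * \<beta>\<^sup>2"
    and pos: "0 < B" "0 < \<beta>" "0 < \<gamma>" "\<gamma> \<le> 1" "0 < K" "0 < c\<^sub>0"
    and n: "0 < n" "1 \<le> 4 * K * \<beta> * sqrt (real n)"
    and D: "c\<^sub>0 * sqrt (real n) \<le> D" "D \<le> exp (c * real n)"
  shows "kernel_LCD_prob (n - 1) n (K * sqrt (real n)) \<gamma> \<alpha> {ereal D..<ereal (2 * D)}
    \<le> ennreal (A * exp 5 * exp (- 2 * real n))" (is "?lhs \<le> _")
proof -
  define w where "w = D / sqrt (real n)"
  define G where "G = 8 * B * K * \<beta> / \<gamma>"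
  have "0 < D" using D(1) pos n(1) by (intro less_le_trans[OF _ D(1)]) simp
  have "1 \<le> sqrt (real n)" using n(1) by simp
  then have "D * 1 \<le> D * sqrt (real n)" using \<open>0 < D\<close> by (intro mult_left_mono) auto
  then have w: "0 < w" "c\<^sub>0 \<le> w" "w \<le> D"
    using \<open>0 < D\<close> D(1) n(1) by (auto simp: w_def field_simps)
  have "c * real n \<le> 1 * real n" using c(1) by (intro mult_right_mono) auto
  then have "exp (c * real n) \<le> exp (real n)" by simp
  then have w_exp: "w \<le> exp (real n)" using w(3) D(2) by linarith
  have \<alpha>_pos: "0 < \<alpha>" using pos n(1) by (simp add: \<alpha>)
  have t_ge: "1 / D \<le> t" unfolding t \<alpha> using n(2) \<open>0 < D\<close> by (intro divide_right_mono) (auto simp: mult_ac)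
  have "exp (- \<kappa> * \<alpha>\<^sup>2) \<le> exp (- (c * real n))"
    using mult_right_mono[OF c(2), of "real n"] by (simp add: \<alpha> power_mult_distrib)
  then have "t / \<gamma> + exp (- \<kappa> * \<alpha>\<^sup>2) \<le> 2 * (t / \<gamma>)"
    using divide_plus_exp_minus_le[OF pos(3,4) \<open>0 < D\<close> D(2) t_ge] by linarith
  then have "B * (t / \<gamma> + exp (- \<kappa> * \<alpha>\<^sup>2)) \<le> B * (2 * (t / \<gamma>))" using pos by (intro mult_left_mono) auto
  also have "\<dots> = G / w" by (simp add: G_def w_def t \<alpha> ac_simps)
  finally have "?lhs \<le> ennreal (exp (real n) * (1 + 8 * w) ^ n * (exp (real n / 2) * (G / w) ^ (n - 1)))"
    unfolding w_def using n(1) \<open>0 < D\<close> \<alpha>_pos pos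
    by (intro kernel_LCD_level_le[OF _ t] order_trans[OF laplace[OF _ _ t_ge] ennreal_leI]) (auto simp: G_def)
  also have "\<dots> \<le> ennreal (exp (real n) * (A * w) ^ n * (exp (real n / 2) * (G / w) ^ (n - 1)))"
  proof (intro ennreal_leI mult_right_mono mult_left_mono power_mono)
    have "1 \<le> 1 / c\<^sub>0 * w" using w pos by (simp add: field_simps)
    then show "1 + 8 * w \<le> A * w" by (simp add: A(1) distrib_right)
  qed (use w pos in \<open>auto simp: G_def\<close>)
  also have "\<dots> \<le> ennreal (A * exp 5 * exp (- 2 * real n))"
    using w(1) w_exp n(1) A pos by (intro ennreal_leI level_union_bound) (auto simp: G_def add_pos_pos)
  finally show ?thesis .
qed

lemma LCD_level_rare:
  assumes K: "0 < K" and \<gamma>: "0 < \<gamma>" "\<gamma> \<le> 1" and c\<^sub>0: "0 < c\<^sub>0"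
  obtains \<beta> c C where "0 < \<beta>" "0 < c" "c \<le> 1" "0 < C"
    "\<forall>\<^sub>F n in sequentially. \<forall>D. c\<^sub>0 * sqrt (real n) \<le> D \<and> D \<le> exp (c * real n) \<longrightarrow>
      kernel_LCD_prob (n - 1) n (K * sqrt (real n)) \<gamma> (\<beta> * sqrt (real n)) {ereal D..<ereal (2 * D)}
      \<le> ennreal (C * exp (- 2 * real n))"
proof -
  obtain B \<kappa> where B: "0 < B" and \<kappa>: "0 < \<kappa>" and small_ball:
    "\<And>n x D \<gamma> \<alpha> t. \<lbrakk>vnorm n x = 1; ereal D \<le> LCD n \<gamma> \<alpha> x; 0 < \<gamma>; 0 < \<alpha>; 0 < D; 1 / D \<le> t\<rbrakk> \<Longrightarrow>
      (\<integral>\<^sup>+s. ennreal (exp (- (s / t)\<^sup>2 / 2)) \<partial>form_law n x) \<le> ennreal (B * (t / \<gamma> + exp (- \<kappa> * \<alpha>\<^sup>2)))"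
    using small_ball_LCD[OF not_AE_const] by blast
  define A where "A = 8 + 1 / c\<^sub>0"
  define \<beta> where "\<beta> = exp (- 5) * \<gamma> / (8 * B * K * A)"
  define c where "c = min 1 (\<kappa> * \<beta>\<^sup>2)"
  have A: "0 < A" using c\<^sub>0 by (simp add: A_def add_pos_pos)
  have \<beta>: "0 < \<beta>" "A * (8 * B * K * \<beta> / \<gamma>) = exp (- 5)" using \<gamma> B K A by (auto simp: \<beta>_def)
  have c: "0 < c" "c \<le> 1" "c \<le> \<kappa> * \<beta>\<^sup>2" using \<kappa> \<beta>(1) by (auto simp: c_def)
  have "\<forall>\<^sub>F n in sequentially. 0 < n \<and> 1 \<le> 4 * K * \<beta> * sqrt (real n)"
    using K \<beta>(1) by (intro eventually_conj eventually_gt_at_top eventually_le_mult_sqrt) auto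
  then have "\<forall>\<^sub>F n in sequentially. \<forall>D. c\<^sub>0 * sqrt (real n) \<le> D \<and> D \<le> exp (c * real n) \<longrightarrow>
      kernel_LCD_prob (n - 1) n (K * sqrt (real n)) \<gamma> (\<beta> * sqrt (real n)) {ereal D..<ereal (2 * D)}
      \<le> ennreal (A * exp 5 * exp (- 2 * real n))"
  proof (eventually_elim, intro allI impI, elim conjE)
    fix n D
    assume n: "0 < n" "1 \<le> 4 * K * \<beta> * sqrt (real n)" and D: "c\<^sub>0 * sqrt (real n) \<le> D" "D \<le> exp (c * real n)"
    have "0 < D" using D(1) c\<^sub>0 n(1) by (intro less_le_trans[OF _ D(1)]) simp
    with n(1) \<beta>(1) \<gamma>(1)
    show "kernel_LCD_prob (n - 1) n (K * sqrt (real n)) \<gamma> (\<beta> * sqrt (real n)) {ereal D..<ereal (2 * D)}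
      \<le> ennreal (A * exp 5 * exp (- 2 * real n))"
      by (intro kernel_LCD_level_le_exp[OF small_ball refl refl A_def \<beta>(2) c(2,3) B \<beta>(1) \<gamma> K c\<^sub>0 n D]) auto
  qed
  with \<beta>(1) c(1,2) A show thesis by (intro that[of \<beta> c "A * exp 5"]) auto
qed

lemma intermediate_LCD_rare:
  assumes K: "0 < K" and \<gamma>: "0 < \<gamma>" "\<gamma> \<le> 1" and c\<^sub>0: "0 < c\<^sub>0"
  obtains \<beta> c C where "0 < \<beta>" "0 < c" "0 < C"
    "\<forall>\<^sub>F n in sequentially. kernel_LCD_prob (n - 1) n (K * sqrt (real n)) \<gamma> (\<beta> * sqrt (real n))
          {ereal (c\<^sub>0 * sqrt (real n))..<ereal (exp (c * real n))}
      \<le> ennreal (C * exp (- real n))"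
proof -
  obtain \<beta> c C where pos: "0 < \<beta>" "0 < c" "c \<le> 1" "0 < C" and level:
    "\<forall>\<^sub>F n in sequentially. \<forall>D. c\<^sub>0 * sqrt (real n) \<le> D \<and> D \<le> exp (c * real n) \<longrightarrow>
      kernel_LCD_prob (n - 1) n (K * sqrt (real n)) \<gamma> (\<beta> * sqrt (real n)) {ereal D..<ereal (2 * D)}
      \<le> ennreal (C * exp (- 2 * real n))"
    using LCD_level_rare[OF assms] .
  have "\<forall>\<^sub>F n in sequentially. 1 \<le> c\<^sub>0 * sqrt (real n)" using c\<^sub>0 by (rule eventually_le_mult_sqrt)
  with level have "\<forall>\<^sub>F n in sequentially. kernel_LCD_prob (n - 1) n (K * sqrt (real n)) \<gamma> (\<beta> * sqrt (real n))
          {ereal (c\<^sub>0 * sqrt (real n))..<ereal (exp (c * real n))}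
      \<le> ennreal (2 * C * exp (- real n))"
  proof eventually_elim
    case (elim n)
    let ?a = "c\<^sub>0 * sqrt (real n)"
    have "exp (c * real n) \<le> exp 1 ^ n"
      using mult_right_mono[OF pos(3), of "real n"] by (simp flip: exp_of_nat_mult)
    also have "\<dots> \<le> 4 ^ n" using exp_le by (intro power_mono) auto
    also have "\<dots> \<le> ?a * 4 ^ n" using elim(2) mult_right_mono[of 1 ?a "4 ^ n"] by simp
    finally have "exp (c * real n) \<le> ?a * 2 ^ (2 * n)" by (simp add: power_mult)
    then have "kernel_LCD_prob (n - 1) n (K * sqrt (real n)) \<gamma> (\<beta> * sqrt (real n)) {ereal ?a..<ereal (exp (c * real n))}
        \<le> ennreal ((2 * n) * (C * exp (- 2 * real n)))"
      using elim pos by (intro kernel_LCD_dyadic_le) auto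
    also have "\<dots> \<le> ennreal (2 * exp (real n) * (C * exp (- 2 * real n)))"
    proof (intro ennreal_leI mult_right_mono)
      show "real (2 * n) \<le> 2 * exp (real n)"
        using exp_ge_add_one_self[of "real n"] unfolding of_nat_mult by linarith
    qed (use pos in simp)
    also have "2 * exp (real n) * (C * exp (- 2 * real n)) = 2 * C * exp (- real n)"
      by (simp flip: exp_add)
    finally show ?case .
  qed
  with pos show thesis by (intro that[of \<beta> c "2 * C"]) auto
qed

theorem kernel_LCD_rare:
  obtains \<gamma> \<beta> c c' where "0 < \<gamma>" "\<gamma> < 1" "0 < \<beta>" "0 < c" "0 < c'"
    "\<forall>\<^sub>F n in sequentially. outer_measure_of (matrix_law (n - 1) n)
        {\<omega> \<in> space (matrix_law (n - 1) n).
          \<exists>z\<in>unit_kernel (n - 1) n \<omega>. LCD n \<gamma> (\<beta> * sqrt (real n)) z < ereal (exp (c * real n))}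
      \<le> ennreal (exp (- c' * real n))"
proof -
  define K where "K = 4 / 3 * sqrt (30 * (V + 1))"
  have K: "0 < K" using variance_proxyD(1)[OF proxy] by (simp add: K_def)
  obtain \<delta> c\<^sub>0 \<gamma> where \<delta>: "0 < \<delta>" and c\<^sub>0: "0 < c\<^sub>0" and \<gamma>: "0 < \<gamma>" "\<gamma> < 1" and small:
    "\<And>n \<alpha>. 0 < n \<Longrightarrow> kernel_LCD_prob (n - 1) n (K * sqrt (real n)) \<gamma> \<alpha> {..<ereal (c\<^sub>0 * sqrt (real n))}
        \<le> ennreal (exp (4 * \<delta> - \<delta> * real n))"
    by (rule small_LCD_rare[OF K]) blast
  obtain \<beta> c C where pos: "0 < \<beta>" "0 < c" "0 < C" and intermediate:
    "\<forall>\<^sub>F n in sequentially. kernel_LCD_prob (n - 1) n (K * sqrt (real n)) \<gamma> (\<beta> * sqrt (real n))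
          {ereal (c\<^sub>0 * sqrt (real n))..<ereal (exp (c * real n))}
      \<le> ennreal (C * exp (- real n))"
    using intermediate_LCD_rare[OF K \<gamma>(1) less_imp_le[OF \<gamma>(2)] c\<^sub>0] .
  define c' where "c' = min \<delta> 1 / 2"
  have c': "0 < c'" "2 * c' \<le> \<delta>" "2 * c' \<le> 1" using \<delta> by (auto simp: c'_def)
  have "\<forall>\<^sub>F n in sequentially. outer_measure_of (matrix_law (n - 1) n)
        {\<omega> \<in> space (matrix_law (n - 1) n).
          \<exists>z\<in>unit_kernel (n - 1) n \<omega>. LCD n \<gamma> (\<beta> * sqrt (real n)) z < ereal (exp (c * real n))}
      \<le> ennreal (exp (- c' * real n))"
    using intermediate eventually_exponentials_le[OF c' less_imp_le[OF pos(3)], of "4 * \<delta>"] eventually_gt_at_top[of 0]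
  proof eventually_elim
    case (elim n)
    have "outer_measure_of (matrix_law (n - 1) n) {\<omega> \<in> space (matrix_law (n - 1) n).
          \<exists>z\<in>unit_kernel (n - 1) n \<omega>. LCD n \<gamma> (\<beta> * sqrt (real n)) z < ereal (exp (c * real n))}
        \<le> ennreal (exp (- real n)) + (ennreal (exp (4 * \<delta> - \<delta> * real n)) + ennreal (C * exp (- real n)))"
      using elim(3)
      by (intro order_trans[OF kernel_LCD_less_le[where R = "K * sqrt (real n)" and a = "c\<^sub>0 * sqrt (real n)"]]
          add_mono unbounded_operator_rare[OF proxy, folded K_def] small elim(1)) auto
    also have "\<dots> = ennreal (exp (- real n) + exp (4 * \<delta> - \<delta> * real n) + C * exp (- real n))"
      using pos by (simp add: add.assoc flip: ennreal_plus)
    also have "\<dots> \<le> ennreal (exp (- c' * real n))"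
      using elim(2) by (intro ennreal_leI) simp
    finally show ?case .
  qed
  with \<gamma> pos c'(1) show thesis by (intro that)
qed

end

theorem theorem7p1:
  fixes \<mu> :: "real measure"
  assumes "prob_space \<mu>"
    and "sets \<mu> = sets borel"
    and "subgaussian \<mu>"
    and "integrable \<mu> (\<lambda>x. x)" and "(\<integral>x. x \<partial>\<mu>) = 0"
    and "integrable \<mu> (\<lambda>x. x\<^sup>2)" and "(\<integral>x. x\<^sup>2 \<partial>\<mu>) = 1"
  shows "\<exists>\<gamma> \<beta> c c' (n0::nat). 0 < \<gamma> \<and> \<gamma> < 1 \<and> \<beta> > 0 \<and> c > 0 \<and> c' > 0 \<and>
    (\<forall>n\<ge>n0. \<exists>A \<in> sets (PiM ({..<n-1} \<times> {..<n}) (\<lambda>_. \<mu>)).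
       {\<omega> \<in> space (PiM ({..<n-1} \<times> {..<n}) (\<lambda>_. \<mu>)).
          \<exists>Z :: nat \<Rightarrow> real. vnorm n Z = 1 \<and>
            (\<forall>i<n-1. (\<Sum>j<n. Z j * \<omega> (i, j)) = 0) \<and>
            LCD n \<gamma> (\<beta> * sqrt (real n)) Z < ereal (exp (c * real n))} \<subseteq> A \<and>
       measure (PiM ({..<n-1} \<times> {..<n}) (\<lambda>_. \<mu>)) A \<le> exp (- c' * real n))"
proof -
  interpret standardized_distribution \<mu>
    using assms by (simp add: standardized_distribution_def standardized_distribution_axioms_def
        real_distribution_def real_distribution_axioms_def)
  obtain V where "variance_proxy \<mu> V" using subgaussian_variance_proxy[OF assms(3) mean] .
  then interpret standardized_subgaussian \<mu> V by unfold_locales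
  let ?P = "\<lambda>n. matrix_law (n - 1) n"
  let ?E = "\<lambda>n \<gamma> \<beta> c. {\<omega> \<in> space (?P n).
    \<exists>z\<in>unit_kernel (n - 1) n \<omega>. LCD n \<gamma> (\<beta> * sqrt (real n)) z < ereal (exp (c * real n))}"
  obtain \<gamma> \<beta> c c' where pos: "0 < \<gamma>" "\<gamma> < 1" "0 < \<beta>" "0 < c" "0 < c'"
    and "\<forall>\<^sub>F n in sequentially. outer_measure_of (?P n) (?E n \<gamma> \<beta> c) \<le> ennreal (exp (- c' * real n))"
    by (rule kernel_LCD_rare)
  then obtain n0 where rare: "\<And>n. n0 \<le> n \<Longrightarrow> outer_measure_of (?P n) (?E n \<gamma> \<beta> c) \<le> ennreal (exp (- c' * real n))"
    by (auto simp: eventually_sequentially)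
  have "\<forall>n\<ge>n0. \<exists>A\<in>sets (?P n). ?E n \<gamma> \<beta> c \<subseteq> A \<and> measure (?P n) A \<le> exp (- c' * real n)"
    by (intro allI impI prob_space.measurable_cover_of_outer_measure_le prob_space_PiM_const rare) auto
  with pos show ?thesis
    unfolding unit_kernel_def mat_vec_def Bex_def mem_Collect_eq conj_assoc by blast
qed

end
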